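(* Consider the following random process (the random game of plates and olives). It starts at time $0$ with an empty table. At each time step, one move is chosen uniformly at random among all moves available in the current configuration and performed, where the available moves are: ($P^+$) add one new empty plate to the table (always exactly one such move); ($P^-$) if there are $\ell\ge 2$ plates, choose an unordered pair of distinct plates ($\binom{\ell}{2}$ such moves), put all olives of both plates onto one of them, and remove the other plate from the table; ($O^+$) choose any plate ($\ell$ such moves) and add one olive to it; ($O^-$) choose any plate that has at least one olive (one move per non-empty plate) and remove one olive from it. Plates are distinguishable, olives on a plate are indistinguishable, and the process never returns to an empty table. Let $O_t$ denote the total number of olives on the table at time $t$. Then: (a) there exist absolute constants $C>0$ and $c_1,c_2$ with $\frac{1}{342}\le c_1\le c_2\le \frac{2}{3}$ such that $\Pr(c_1 t\le O_t\le c_2 t)\ge 1-e^{-Ct}$; (b) there exists an absolute constant $A>0$ such that for every $\delta\ge 0$, $\Pr(|O_t-\mathbb{E}(O_t)|\ge \delta t)\le e^{-A\delta^2 t}$; (c) there is an absolute constant $B>0$ such that, with probability tending to $1$ as $t\to\infty$, at no time up to $t$ does any plate other than the first plate (the plate created by the first move) have more than $B\log t$ olives.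
   Context: The first move is necessarily $P^+$, creating the first plate. With one plate on the table, the available moves are $P^+$, $O^+$ on that plate, and $O^-$ if that plate is non-empty; in particular the table never becomes empty again. When two plates are combined, the surviving plate is one of the two; the first plate is regarded as persisting throughout (when it is combined with another plate, it is the one kept). "With high probability" means with probability tending to $1$ as the total number of moves $t\to\infty$.
   Formalization: In (a) the time t = 1 is excluded, since O_1 = 0 surely makes the claim false there; in (b) the bound is stated only when δ²t ≥ K for an absolute constant K, since for tiny δ (e.g. t = 2, δ = 1/4) it is false as written. *)

theory Defs
  imports "HOL-Probability.Probability"
begin

text \<open>
  A table is the list of olive counts of its plates, in order of creation. The plates of a merged
  pair are named by their indices \<open>i < j\<close>, so that each unordered pair is one move, and the older
  plate \<open>i\<close> is the one kept. Hence index 0 is always the plate created by the first move; which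
  plate survives a merger not involving it has no effect on the collection of olive counts.
\<close>

type_synonym table = "nat list"

datatype move = Add_Plate | Merge nat nat | Add_Olive nat | Remove_Olive nat

definition moves :: "table \<Rightarrow> move set" where
  "moves xs =
     {Add_Plate} \<union>
     {Merge i j | i j. i < j \<and> j < length xs} \<union>
     {Add_Olive i | i. i < length xs} \<union>
     {Remove_Olive i | i. i < length xs \<and> 0 < xs ! i}"

fun perform :: "move \<Rightarrow> table \<Rightarrow> table" where
  "perform Add_Plate xs = xs @ [0]"
| "perform (Merge i j) xs = (let ys = xs[i := xs ! i + xs ! j] in take j ys @ drop (Suc j) ys)"
| "perform (Add_Olive i) xs = xs[i := xs ! i + 1]"
| "perform (Remove_Olive i) xs = xs[i := xs ! i - 1]"

text \<open>
  The joint law of the tables at times \<open>0, \<dots>, t\<close>: in a list \<open>h\<close> in its support, \<open>h ! s\<close> is the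
  table at time \<open>s\<close>.
\<close>

primrec game :: "nat \<Rightarrow> table list pmf" where
  "game 0 = return_pmf [[]]"
| "game (Suc t) =
     bind_pmf (game t) (\<lambda>h.
       map_pmf (\<lambda>m. h @ [perform m (last h)]) (pmf_of_set (moves (last h))))"

definition olives :: "table \<Rightarrow> real" where
  "olives xs = real (sum_list xs)"

text \<open>\<open>pmf_of_set\<close> is the uniform distribution only for finite nonempty sets.\<close>

lemma moves_nonempty: "moves xs \<noteq> {}"
  by (simp add: moves_def)

lemma finite_moves: "finite (moves xs)"
proof -
  have "{Merge i j | i j. i < j \<and> j < length xs}
      \<subseteq> (\<lambda>(i, j). Merge i j) ` ({..<length xs} \<times> {..<length xs})"
    by auto
  then have "finite {Merge i j | i j. i < j \<and> j < length xs}"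
    by (rule finite_subset) simp
  then show ?thesis
    by (simp add: moves_def)
qed

end

theory Submission
  imports Defs "HOL-Real_Asymp.Real_Asymp"
begin

text \<open>
  Two Lyapunov functions and one second-order corrector carry the proof.

  A function \<open>20 * k + \<phi>(other plates)\<close>, with \<open>k\<close> the content of the first plate, has
  bounded-below increments and drift at least \<open>1/5\<close> per move, so \<open>k\<close> exceeds \<open>t / 342\<close> up to an
  exponentially small probability. An olive is added with conditional probability at most \<open>1/2\<close>,
  which bounds the number of olives from above. The number of olives on the other plates grows by
  at most one per move and is reset whenever a single plate is left; since the number of plates is
  strongly pushed down, it has uniformly exponential tails.

  For the concentration, consider the game in which the first plate is never empty. It regenerates
  whenever a single plate is left. Let \<open>u n zs\<close> be the expected gain in \<open>n\<close> moves when the other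
  plates are \<open>zs\<close>. The gain has exponential moments bounded by
  \<open>exp (l * u n [] + c * l\<^sup>2 * n) * (1 + l * (u n zs - u n []) + O(l\<^sup>2))\<close>, by induction on \<open>n\<close>. In the
  actual game the first plate is non-empty after time \<open>s\<close> except with probability exponentially
  small in \<open>s\<close>, and the first \<open>s\<close> moves change the olive count by at most \<open>s\<close>, so taking \<open>s\<close> of
  order \<open>\<delta> * t\<close> gives the Gaussian tail around \<open>u t []\<close>. That tail forces \<open>u t []\<close> to be within
  \<open>O(sqrt t)\<close> of the mean.
\<close>

section \<open>Moves\<close>

definition mean :: "'a set \<Rightarrow> ('a \<Rightarrow> real) \<Rightarrow> real" where
  "mean S f = sum f S / real (card S)"

lemma mean_mono: "(\<And>x. x \<in> S \<Longrightarrow> f x \<le> g x) \<Longrightarrow> mean S f \<le> mean S g"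
  unfolding mean_def by (intro divide_right_mono sum_mono) auto

lemma mean_cong: "(\<And>x. x \<in> S \<Longrightarrow> f x = g x) \<Longrightarrow> mean S f = mean S g"
  unfolding mean_def by (metis sum.cong)

lemma mean_add: "mean S (\<lambda>x. f x + g x) = mean S f + mean S g"
  by (simp add: mean_def sum.distrib add_divide_distrib)

lemma mean_cmult: "mean S (\<lambda>x. c * f x) = c * mean S f"
  by (simp add: mean_def sum_distrib_left)

lemma mean_const: "finite S \<Longrightarrow> S \<noteq> {} \<Longrightarrow> mean S (\<lambda>_. c) = c"
  by (simp add: mean_def)

lemma mean_nonneg: "(\<And>x. x \<in> S \<Longrightarrow> 0 \<le> f x) \<Longrightarrow> 0 \<le> mean S f"
  unfolding mean_def by (intro divide_nonneg_nonneg sum_nonneg) auto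

lemma mean_abs_le:
  assumes "finite S" "S \<noteq> {}" "\<And>x. x \<in> S \<Longrightarrow> \<bar>f x\<bar> \<le> g x"
  shows "\<bar>mean S f\<bar> \<le> mean S g"
proof -
  have "mean S f \<le> mean S g" using assms(3) by (intro mean_mono) (auto simp: abs_le_iff)
  moreover have "mean S (\<lambda>x. (-1) * f x) \<le> mean S g"
    using assms(3) by (intro mean_mono) (auto simp: abs_le_iff)
  ultimately show ?thesis unfolding mean_cmult by (simp add: abs_le_iff)
qed

section \<open>Enumerating and counting the moves\<close>

definition pairs :: "nat \<Rightarrow> (nat \<times> nat) set" where
  "pairs n = {(i, j). i < j \<and> j < n}"

lemma finite_pairs [simp]: "finite (pairs n)"
proof -
  have "pairs n \<subseteq> {..<n} \<times> {..<n}" by (auto simp: pairs_def)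
  then show ?thesis by (rule finite_subset) (intro finite_cartesian_product finite_lessThan)
qed

lemma pairs_Suc: "pairs (Suc n) = pairs n \<union> (\<lambda>i. (i, n)) ` {..<n}"
  by (auto simp: pairs_def less_Suc_eq)

lemma card_pairs: "real (card (pairs n)) = real n * (real n - 1) / 2"
proof (induction n)
  case 0
  then show ?case by (simp add: pairs_def)
next
  case (Suc n)
  have "card (pairs (Suc n)) = card (pairs n) + card ((\<lambda>i. (i, n)) ` {..<n})"
    unfolding pairs_Suc by (intro card_Un_disjoint finite_pairs finite_imageI finite_lessThan) (auto simp: pairs_def)
  also have "card ((\<lambda>i. (i, n)) ` {..<n}) = n"
    by (subst card_image) (auto simp: inj_on_def)
  finally show ?case using Suc by (simp add: field_simps)
qed

text \<open>The four kinds of moves are disjoint images of index sets under injective constructors.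
  The number of moves and the drifts of the Lyapunov functions are computed through this
  splitting.\<close>

lemma sum_moves:
  fixes f :: "move \<Rightarrow> real"
  shows "sum f (moves xs) = f Add_Plate + (\<Sum>(i, j)\<in>pairs (length xs). f (Merge i j))
    + (\<Sum>i<length xs. f (Add_Olive i)) + (\<Sum>i | i < length xs \<and> 0 < xs ! i. f (Remove_Olive i))"
proof -
  let ?M = "(\<lambda>(i, j). Merge i j) ` pairs (length xs)" and ?A = "Add_Olive ` {..<length xs}"
  let ?R = "Remove_Olive ` {i. i < length xs \<and> 0 < xs ! i}"
  have eq: "moves xs = (({Add_Plate} \<union> ?M) \<union> ?A) \<union> ?R"
    by (force simp: moves_def pairs_def image_iff)
  have "sum f (moves xs) = sum f {Add_Plate} + sum f ?M + sum f ?A + sum f ?R"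
  proof -
    have fin: "finite ?M" "finite ?A" "finite ?R" by auto
    have "sum f (moves xs) = sum f (({Add_Plate} \<union> ?M) \<union> ?A) + sum f ?R"
      unfolding eq using fin by (intro sum.union_disjoint) auto
    also have "sum f (({Add_Plate} \<union> ?M) \<union> ?A) = sum f ({Add_Plate} \<union> ?M) + sum f ?A"
      using fin by (intro sum.union_disjoint) auto
    also have "sum f ({Add_Plate} \<union> ?M) = sum f {Add_Plate} + sum f ?M"
      using fin by (intro sum.union_disjoint) auto
    finally show ?thesis .
  qed
  also have "sum f ?M = (\<Sum>(i, j)\<in>pairs (length xs). f (Merge i j))"
    by (subst sum.reindex) (auto simp: inj_on_def intro!: sum.cong)
  also have "sum f ?A = (\<Sum>i<length xs. f (Add_Olive i))"
    by (subst sum.reindex) (auto simp: inj_on_def)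
  also have "sum f ?R = (\<Sum>i | i < length xs \<and> 0 < xs ! i. f (Remove_Olive i))"
    by (subst sum.reindex) (auto simp: inj_on_def)
  finally show ?thesis by simp
qed

lemma card_moves:
  "real (card (moves xs)) =
    1 + real (length xs) * (real (length xs) - 1) / 2 + real (length xs)
    + real (card {i. i < length xs \<and> 0 < xs ! i})"
  using sum_moves[of "\<lambda>_. 1" xs] by (simp add: card_pairs split_def)

lemma card_nonempty_plates: "card {i. i < length xs \<and> 0 < xs ! i} \<le> length xs"
  using card_mono[of "{..<length xs}" "{i. i < length xs \<and> 0 < xs ! i}"] by auto

lemma card_moves_pos [simp]: "0 < card (moves xs)"
  by (simp add: card_gt_0_iff finite_moves moves_nonempty)

lemma mean_moves_const [simp]: "mean (moves xs) (\<lambda>_. c) = c"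
  by (simp add: mean_const finite_moves moves_nonempty)

text \<open>Clears the denominator: a drift estimate becomes an inequality between a total increment
  and the number of moves.\<close>

lemma mean_moves_le:
  assumes "(\<Sum>m\<in>moves xs. f m - c) \<le> e * real (card (moves xs))"
  shows "mean (moves xs) f \<le> c + e"
proof -
  have "sum f (moves xs) \<le> (c + e) * real (card (moves xs))"
    using assms by (simp add: sum_subtractf algebra_simps)
  then show ?thesis
    unfolding mean_def using card_moves_pos[of xs] by (simp add: divide_le_eq)
qed

section \<open>Effect of a move on the olives and on the number of plates\<close>

lemma sum_list_delete:
  "j < length xs \<Longrightarrow> sum_list (take j xs @ drop (Suc j) xs) + xs ! j = sum_list (xs :: nat list)"
  by (subst (4) id_take_nth_drop[of j xs]) simp_all

lemma sum_list_merge: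
  assumes "i < j" "j < length xs"
  shows "sum_list (perform (Merge i j) xs) = sum_list xs"
proof -
  let ?ys = "xs[i := xs ! i + xs ! j]"
  have "sum_list (take j ?ys @ drop (Suc j) ?ys) + ?ys ! j = sum_list ?ys"
    by (rule sum_list_delete) (use assms in auto)
  moreover have "sum_list ?ys = sum_list xs + xs ! j"
    using assms by (simp add: sum_list_update)
  ultimately show ?thesis using assms by (simp add: Let_def)
qed

lemma olives_perform:
  assumes "m \<in> moves xs"
  shows "olives (perform m xs) - olives xs =
    (case m of Add_Olive _ \<Rightarrow> 1 | Remove_Olive _ \<Rightarrow> -1 | _ \<Rightarrow> 0)"
proof (cases m)
  case (Remove_Olive i)
  then have i: "i < length xs" "0 < xs ! i" using assms by (auto simp: moves_def)
  then have "sum_list (xs[i := xs ! i - 1]) + 1 = sum_list xs"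
    using elem_le_sum_list[of i xs] by (simp add: sum_list_update)
  then have "real (sum_list (xs[i := xs ! i - 1])) + 1 = real (sum_list xs)"
    by (metis of_nat_1 of_nat_add)
  then show ?thesis using Remove_Olive by (simp add: olives_def)
next
  case (Merge i j)
  then have "i < j" "j < length xs" using assms by (auto simp: moves_def)
  then show ?thesis using Merge by (simp add: olives_def sum_list_merge del: perform.simps)
qed (use assms in \<open>auto simp: moves_def olives_def sum_list_update\<close>)

lemma length_perform:
  assumes "m \<in> moves xs"
  shows "length (perform m xs) =
    (case m of Add_Plate \<Rightarrow> Suc (length xs) | Merge _ _ \<Rightarrow> length xs - 1 | _ \<Rightarrow> length xs)"
  using assms by (auto simp: moves_def Let_def split: move.splits)

text \<open>One move raises the number of plates while quadratically many lower it; this imbalance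
  drives the game back to a single plate.\<close>

lemma sum_length_drift:
  fixes f :: "nat \<Rightarrow> real"
  shows "(\<Sum>m\<in>moves xs. f (length (perform m xs)) - f (length xs)) =
    f (Suc (length xs)) - f (length xs)
    + real (length xs) * (real (length xs) - 1) / 2 * (f (length xs - 1) - f (length xs))"
proof -
  let ?n = "length xs"
  have "(\<Sum>m\<in>moves xs. f (length (perform m xs)) - f ?n) =
    (\<Sum>m\<in>moves xs. (case m of Add_Plate \<Rightarrow> f (Suc ?n) | Merge _ _ \<Rightarrow> f (?n - 1) | _ \<Rightarrow> f ?n) - f ?n)"
    by (intro sum.cong refl) (auto simp: length_perform split: move.splits)
  also have "\<dots> = f (Suc ?n) - f ?n + real ?n * (real ?n - 1) / 2 * (f (?n - 1) - f ?n)"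
    unfolding sum_moves by (simp add: split_def card_pairs)
  finally show ?thesis .
qed

section \<open>The law of the table at a given time\<close>

definition law :: "nat \<Rightarrow> table pmf" where
  "law t = map_pmf last (game t)"

lemma finite_game [simp]: "finite (set_pmf (game t))"
  by (induction t) (auto simp: finite_moves moves_nonempty)

lemma finite_law [simp]: "finite (set_pmf (law t))"
  by (simp add: law_def)

lemma integrable_game [simp]: "integrable (measure_pmf (game t)) (f :: _ \<Rightarrow> real)"
  by (rule integrable_measure_pmf_finite) simp

lemma integrable_law [simp]: "integrable (measure_pmf (law t)) (f :: _ \<Rightarrow> real)"
  by (rule integrable_measure_pmf_finite) simp

lemma length_game: "h \<in> set_pmf (game t) \<Longrightarrow> length h = Suc t"
  by (induction t arbitrary: h) (auto simp: finite_moves moves_nonempty)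

lemma game_last: "h \<in> set_pmf (game t) \<Longrightarrow> h ! t = last h"
  using length_game[of h t] by (cases h rule: rev_cases) (auto simp: nth_append)

text \<open>Later moves only append to the history, so the entry at time \<open>s\<close> keeps its
  law.\<close>

lemma game_law: "s \<le> t \<Longrightarrow> map_pmf (\<lambda>h. h ! s) (game t) = law s"
proof (induction t rule: dec_induct)
  case base
  show ?case unfolding law_def by (intro map_pmf_cong refl) (simp add: game_last)
next
  case (step t)
  have "map_pmf (\<lambda>h. h ! s) (game (Suc t)) = bind_pmf (game t) (\<lambda>h.
       map_pmf (\<lambda>m. (h @ [perform m (last h)]) ! s) (pmf_of_set (moves (last h))))"
    by (simp add: map_bind_pmf map_pmf_comp)
  also have "\<dots> = bind_pmf (game t) (\<lambda>h. return_pmf (h ! s))"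
    using step.hyps by (intro bind_pmf_cong refl) (simp add: length_game nth_append)
  finally show ?case using step.IH by (simp add: map_pmf_def)
qed

lemma prob_game_law:
  "s \<le> t \<Longrightarrow> measure_pmf.prob (game t) {h. P (h ! s)} = measure_pmf.prob (law s) {x. P x}"
  by (subst game_law[symmetric]) (auto simp: vimage_def)

lemma expectation_game_law:
  fixes f :: "table \<Rightarrow> real"
  shows "s \<le> t \<Longrightarrow> measure_pmf.expectation (game t) (\<lambda>h. f (h ! s)) = measure_pmf.expectation (law s) f"
  by (subst game_law[symmetric]) simp_all

lemma expectation_game_Suc:
  fixes f :: "table list \<Rightarrow> real"
  shows "measure_pmf.expectation (game (Suc t)) f =
    measure_pmf.expectation (game t) (\<lambda>h. mean (moves (last h)) (\<lambda>m. f (h @ [perform m (last h)])))"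
proof -
  have "measure_pmf.expectation (game (Suc t)) f =
      (\<Sum>h\<in>set_pmf (game t). pmf (game t) h *\<^sub>R measure_pmf.expectation
        (map_pmf (\<lambda>m. h @ [perform m (last h)]) (pmf_of_set (moves (last h)))) f)"
    unfolding game.simps by (rule pmf_expectation_bind) (auto simp: finite_moves moves_nonempty)
  also have "\<dots> = (\<Sum>h\<in>set_pmf (game t). pmf (game t) h *\<^sub>R
      mean (moves (last h)) (\<lambda>m. f (h @ [perform m (last h)])))"
    by (simp add: integral_pmf_of_set finite_moves moves_nonempty mean_def)
  also have "\<dots> = measure_pmf.expectation (game t)
      (\<lambda>h. mean (moves (last h)) (\<lambda>m. f (h @ [perform m (last h)])))"
    by (subst integral_measure_pmf[of "set_pmf (game t)"]) (auto simp: )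
  finally show ?thesis .
qed

text \<open>The next table depends on the history only through the last table. Bounds at a fixed
  time are obtained by induction along this recursion.\<close>

lemma expectation_law_Suc:
  fixes f :: "table \<Rightarrow> real"
  shows "measure_pmf.expectation (law (Suc t)) f =
    measure_pmf.expectation (law t) (\<lambda>x. mean (moves x) (\<lambda>m. f (perform m x)))"
  unfolding law_def integral_map_pmf expectation_game_Suc by simp

lemma law_0: "law 0 = return_pmf []"
  by (simp add: law_def)

lemma set_law_Suc: "set_pmf (law (Suc t)) = (\<Union>x\<in>set_pmf (law t). (\<lambda>m. perform m x) ` moves x)"
  by (auto simp: law_def finite_moves moves_nonempty map_bind_pmf map_pmf_comp)

lemma moves_Nil: "moves [] = {Add_Plate}"
  by (auto simp: moves_def)

lemma expectation_law_1: "measure_pmf.expectation (law (Suc 0)) f = (f [0] :: real)"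
  by (simp add: expectation_law_Suc law_0 moves_Nil mean_def)

lemma perform_nonempty: "xs \<noteq> [] \<Longrightarrow> m \<in> moves xs \<Longrightarrow> perform m xs \<noteq> []"
  using length_perform[of m xs]
  by (auto simp: moves_def simp del: length_0_conv simp flip: length_greater_0_conv)

lemma law_nonempty: "x \<in> set_pmf (law (Suc t)) \<Longrightarrow> x \<noteq> []"
proof (induction t arbitrary: x)
  case 0
  then show ?case by (simp add: set_law_Suc law_0 moves_Nil)
next
  case (Suc t)
  from Suc.prems obtain y m where "y \<in> set_pmf (law (Suc t))" "m \<in> moves y" "x = perform m y"
    unfolding set_law_Suc[of "Suc t"] by blast
  then show ?case using Suc.IH perform_nonempty by simp
qed

lemma expectation_law_mono:
  assumes "\<And>x. x \<in> set_pmf (law t) \<Longrightarrow> f x \<le> (g x :: real)"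
  shows "measure_pmf.expectation (law t) f \<le> measure_pmf.expectation (law t) g"
  by (rule integral_mono_AE) (auto simp: AE_measure_pmf_iff assms)

text \<open>Markov's inequality, with the lower bound on \<open>f\<close> asked for only on the
  support.\<close>

lemma prob_law_le:
  assumes "\<And>x. x \<in> set_pmf (law t) \<Longrightarrow> P x \<Longrightarrow> c \<le> f x" "\<And>x. 0 \<le> f x" "0 < (c :: real)"
  shows "measure_pmf.prob (law t) {x. P x} \<le> measure_pmf.expectation (law t) f / c"
proof -
  have "measure_pmf.prob (law t) {x. P x} = measure_pmf.expectation (law t) (indicator {x. P x})"
    by simp
  also have "\<dots> \<le> measure_pmf.expectation (law t) (\<lambda>x. f x / c)"
    using assms by (intro expectation_law_mono) (auto simp: indicator_def)
  finally show ?thesis by simp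
qed

section \<open>Exponential moments of additive functionals of a regenerative chain\<close>

text \<open>For negative \<open>z\<close> take reciprocals in \<open>1 + w \<le> exp w\<close> and
  use that \<open>1 - w + w\<^sup>2\<close> times \<open>1 + w\<close> is
  \<open>1 + w ^ 3\<close>.\<close>

lemma exp_le_quadratic:
  fixes z :: real
  assumes "\<bar>z\<bar> \<le> 1"
  shows "exp z \<le> 1 + z + z\<^sup>2"
proof (cases "0 \<le> z")
  case True
  then show ?thesis using assms exp_bound[of z] by simp
next
  case False
  define w where "w = - z"
  have w: "0 < w" "w \<le> 1" using False assms by (auto simp: w_def)
  have "exp (- w) = 1 / exp w" by (simp add: exp_minus field_simps)
  also have "\<dots> \<le> 1 / (1 + w)"
    using w exp_ge_add_one_self[of w] by (intro divide_left_mono) auto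
  also have "\<dots> \<le> 1 - w + w\<^sup>2"
  proof -
    have "(1 - w + w\<^sup>2) * (1 + w) = 1 + w ^ 3" by (simp add: power2_eq_square power3_eq_cube algebra_simps)
    then have "1 \<le> (1 - w + w\<^sup>2) * (1 + w)" using w by simp
    then show ?thesis using w by (simp add: divide_le_eq)
  qed
  finally show ?thesis by (simp add: w_def)
qed

text \<open>One tilted step times the corrector, to second order. The first-order terms are kept
  exactly. The remainder \<open>\<rho>\<close> of the exponential is at most
  \<open>4 * l\<^sup>2\<close>, the products of \<open>q\<close> with \<open>l\<^sup>2 * y\<close>
  and with \<open>l * \<rho>\<close> are at most \<open>2 * W * l\<^sup>2\<close> each, and the
  \<open>v\<close> term is inflated by at most \<open>1 + th\<close>.\<close>

lemma exp_tilt_le: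
  fixes l y q W D v th :: real
  assumes l: "\<bar>l\<bar> \<le> 1 / 2" "exp (2 * \<bar>l\<bar>) \<le> 1 + th" and y: "\<bar>y\<bar> \<le> 2" and q: "\<bar>q\<bar> \<le> W"
    and pos: "0 \<le> v" "0 \<le> D"
  shows "exp (l * y) * (1 + l * q + l\<^sup>2 * (D * v))
    \<le> 1 + l * (y + q) + l\<^sup>2 * (4 + 6 * W + D * (1 + th) * v)"
proof -
  define z where "z = l * y"
  define \<rho> where "\<rho> = exp z - 1 - z"
  have az: "\<bar>z\<bar> \<le> 2 * \<bar>l\<bar>" using y unfolding z_def abs_mult by (metis abs_ge_zero mult.commute mult_left_mono)
  then have z1: "\<bar>z\<bar> \<le> 1" using l by simp
  have \<rho>0: "0 \<le> \<rho>" unfolding \<rho>_def using exp_ge_add_one_self[of z] by linarith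
  have "z\<^sup>2 \<le> (2 * \<bar>l\<bar>)\<^sup>2" using az by (metis abs_ge_zero power2_abs power_mono)
  then have \<rho>1: "\<rho> \<le> 4 * l\<^sup>2" using exp_le_quadratic[OF z1] by (simp add: \<rho>_def power_mult_distrib)
  have W0: "0 \<le> W" using q by linarith
  have "y * q \<le> \<bar>y\<bar> * \<bar>q\<bar>" by (metis abs_ge_self abs_mult)
  also have "\<dots> \<le> 2 * W" using y q by (intro mult_mono) auto
  finally have yq: "l\<^sup>2 * (y * q) \<le> l\<^sup>2 * (2 * W)" by (intro mult_left_mono) auto
  have "l * q \<le> \<bar>l\<bar> * \<bar>q\<bar>" by (metis abs_ge_self abs_mult)
  also have "\<dots> \<le> 1 / 2 * W" using l q by (intro mult_mono) auto
  finally have lq: "l * q \<le> W / 2" by simp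
  have "\<rho> * (l * q) \<le> \<rho> * (W / 2)" using lq \<rho>0 by (rule mult_left_mono)
  also have "\<dots> \<le> 4 * l\<^sup>2 * (W / 2)" using \<rho>1 W0 by (intro mult_right_mono) auto
  finally have c3: "\<rho> * (l * q) \<le> l\<^sup>2 * (2 * W)" by (simp add: mult_ac)
  have e: "exp z = 1 + z + \<rho>" by (simp add: \<rho>_def)
  have "exp z * (1 + l * q) = 1 + l * (y + q) + l\<^sup>2 * (y * q) + \<rho> + \<rho> * (l * q)"
    unfolding e by (simp add: z_def power2_eq_square algebra_simps)
  also have "\<dots> \<le> 1 + l * (y + q) + l\<^sup>2 * (4 + 6 * W)"
  proof -
    have "0 \<le> l\<^sup>2 * W" using W0 by simp
    then show ?thesis using yq \<rho>1 c3 by (simp add: algebra_simps)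
  qed
  finally have A: "exp z * (1 + l * q) \<le> 1 + l * (y + q) + l\<^sup>2 * (4 + 6 * W)" .
  have "exp z \<le> exp (2 * \<bar>l\<bar>)" using az by simp
  also have "\<dots> \<le> 1 + th" by (rule l)
  finally have "exp z * (l\<^sup>2 * (D * v)) \<le> (1 + th) * (l\<^sup>2 * (D * v))"
    using pos by (intro mult_right_mono) auto
  with A show ?thesis unfolding z_def by (simp add: algebra_simps)
qed

text \<open>\<open>d\<close> is the increment of an additive functional and \<open>r\<close> the
  regeneration state, at which no drift is demanded. The drift \<open>-2\<close> of \<open>W\<close>
  pays for centred increments, which are at most 2 in size; the contraction
  \<open>1 - 2 * th\<close> of \<open>v\<close> still leaves a loss of order \<open>th\<close> after
  an inflation by \<open>1 + th\<close>.\<close>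

locale regenerative_chain =
  fixes M :: "'s \<Rightarrow> 'm set" and d :: "'s \<Rightarrow> 'm \<Rightarrow> real" and nxt :: "'s \<Rightarrow> 'm \<Rightarrow> 's"
    and r :: 's and W v :: "'s \<Rightarrow> real" and B th :: real
  assumes finite_M: "finite (M x)" and M_nonempty: "M x \<noteq> {}"
    and d_le: "m \<in> M x \<Longrightarrow> \<bar>d x m\<bar> \<le> 1"
    and W_root: "W r = 0" and W_nonneg: "0 \<le> W x"
    and W_drift: "x \<noteq> r \<Longrightarrow> mean (M x) (\<lambda>m. W (nxt x m)) \<le> W x - 2"
    and v_root: "v r = 0" and v_nonneg: "0 \<le> v x"
    and v_drift: "x \<noteq> r \<Longrightarrow> mean (M x) (\<lambda>m. v (nxt x m)) \<le> (1 - 2 * th) * v x"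
    and th_pos: "0 < th" and B_pos: "0 < B"
    and dominates: "x \<noteq> r \<Longrightarrow> 1 + W x + (W x)\<^sup>2 \<le> B * v x"
begin

text \<open>The moment generating function of the total of \<open>d\<close> over \<open>n\<close>
  moves, by conditioning on the first move; no path space is needed.\<close>

primrec mgf :: "real \<Rightarrow> nat \<Rightarrow> 's \<Rightarrow> real" where
  "mgf l 0 x = 1"
| "mgf l (Suc n) x = mean (M x) (\<lambda>m. exp (l * d x m) * mgf l n (nxt x m))"

primrec gain :: "nat \<Rightarrow> 's \<Rightarrow> real" where
  "gain 0 x = 0"
| "gain (Suc n) x = mean (M x) (\<lambda>m. d x m + gain n (nxt x m))"

lemma mean_M_const [simp]: "mean (M x) (\<lambda>_. c) = c"
  by (rule mean_const[OF finite_M M_nonempty])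

lemma mgf_nonneg: "0 \<le> mgf l n x"
  by (induction n arbitrary: x) (auto intro!: mean_nonneg)

text \<open>A longer run has one extra increment at its end; the induction peels off the common
  first move.\<close>

lemma gain_Suc_diff_le: "\<bar>gain (Suc n) x - gain n x\<bar> \<le> 1"
proof (induction n arbitrary: x)
  case 0
  show ?case using mean_abs_le[OF finite_M M_nonempty, of x "d x" "\<lambda>_. 1"] d_le by simp
next
  case (Suc n)
  have "gain (Suc (Suc n)) x - gain (Suc n) x =
      mean (M x) (\<lambda>m. (d x m + gain (Suc n) (nxt x m)) + (-1) * (d x m + gain n (nxt x m)))"
    unfolding mean_add[of _ _ "\<lambda>m. (-1) * (d x m + gain n (nxt x m))"] mean_cmult by simp
  also have "\<bar>\<dots>\<bar> \<le> mean (M x) (\<lambda>_. 1)"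
    using Suc by (intro mean_abs_le finite_M M_nonempty) simp
  finally show ?case by simp
qed

lemma gain_diff_le: "\<bar>gain (n + k) x - gain n x\<bar> \<le> real k"
proof (induction k)
  case (Suc k)
  then show ?case using gain_Suc_diff_le[of "n + k" x] by simp
qed simp

text \<open>A finite-horizon Poisson equation: centring \<open>d\<close> by the growth of the gain
  at the root makes the equation exact, which is what cancels the first-order terms in the
  exponential moment.\<close>

lemma gain_root_Suc:
  "gain (Suc n) x - gain (Suc n) r =
    mean (M x) (\<lambda>m. (d x m - (gain (Suc n) r - gain n r)) + (gain n (nxt x m) - gain n r))"
proof -
  have "mean (M x) (\<lambda>m. (d x m - (gain (Suc n) r - gain n r)) + (gain n (nxt x m) - gain n r))
      = mean (M x) (\<lambda>m. (d x m + gain n (nxt x m)) + (- gain (Suc n) r))"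
    by (intro mean_cong) simp
  also have "\<dots> = gain (Suc n) x - gain (Suc n) r"
    unfolding mean_add[of _ _ "\<lambda>_. - gain (Suc n) r"] by simp
  finally show ?thesis by simp
qed

lemma abs_increment_le: "m \<in> M x \<Longrightarrow> \<bar>d x m - (gain (Suc n) r - gain n r)\<bar> \<le> 2"
  using d_le[of m x] gain_Suc_diff_le[of n r] by simp

text \<open>The difference of gains is built up only until the root is reached; each step
  contributes at most 2, which the drift of \<open>W\<close> pays for.\<close>

lemma gain_root_le: "\<bar>gain n x - gain n r\<bar> \<le> W x"
proof (induction n arbitrary: x)
  case 0
  show ?case by (simp add: W_nonneg)
next
  case (Suc n)
  show ?case
  proof (cases "x = r")
    case True
    then show ?thesis by (simp add: W_root)
  next
    case False
    have "\<bar>gain (Suc n) x - gain (Suc n) r\<bar> \<le> mean (M x) (\<lambda>m. 2 + W (nxt x m))"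
      unfolding gain_root_Suc
    proof (rule mean_abs_le[OF finite_M M_nonempty])
      fix m assume "m \<in> M x"
      then show "\<bar>(d x m - (gain (Suc n) r - gain n r)) + (gain n (nxt x m) - gain n r)\<bar>
          \<le> 2 + W (nxt x m)"
        using abs_increment_le[of m x n] Suc[of "nxt x m"] by linarith
    qed
    also have "\<dots> \<le> W x"
      unfolding mean_add using W_drift[OF False] by simp
    finally show ?thesis .
  qed
qed

lemma W_le: "W x \<le> B * v x" and W_square_le: "(W x)\<^sup>2 \<le> B * v x"
proof -
  show "W x \<le> B * v x"
  proof (cases "x = r")
    case False
    show ?thesis using dominates[OF False] zero_le_power2[of "W x"] by linarith
  qed (simp add: W_root v_root)
  show "(W x)\<^sup>2 \<le> B * v x"
  proof (cases "x = r")
    case False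
    show ?thesis using dominates[OF False] W_nonneg[of x] by linarith
  qed (simp add: W_root v_root)
qed

text \<open>
  The factor \<open>1 + l * (gain n x - gain n r) + l\<^sup>2 * (D * v x)\<close> is a second-order corrector: its
  linear part makes the first-order terms in \<open>l\<close> cancel exactly, the drift of \<open>v\<close> absorbs the
  second-order terms away from the root, and at the root they are paid for by \<open>exp (c * l\<^sup>2)\<close>.
\<close>

theorem mgf_le:
  obtains c D l0 where "0 < c" "0 < D" "0 < l0"
    "\<And>l n x. \<bar>l\<bar> \<le> l0 \<Longrightarrow> mgf l n x \<le>
      exp (l * gain n r + c * l\<^sup>2 * real n) * (1 + l * (gain n x - gain n r) + l\<^sup>2 * (D * v x))"
proof -
  \<comment> \<open>\<open>D * th\<close> has to absorb \<open>6 * B\<close>, and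
    \<open>B \<le> D\<close> makes the corrector non-negative. \<open>c\<close> is the whole
    second-order term at the root, where \<open>W\<close> and \<open>v\<close> vanish.
    \<open>l0\<close> ensures \<open>exp (2 * \<bar>l\<bar>) \<le> 1 + th\<close>.\<close>
  define D where "D = 6 * B / th + B"
  define c where "c = 4 + 6 * mean (M r) (\<lambda>m. W (nxt r m)) + D * (1 + th) * mean (M r) (\<lambda>m. v (nxt r m))"
  define l0 where "l0 = min (1 / 2) (ln (1 + th) / 2)"
  have D: "0 < D" "B \<le> D" "6 * B \<le> D * th"
    using th_pos B_pos by (auto simp: D_def field_simps intro!: add_pos_pos)
  have c: "0 < c"
    unfolding c_def using D th_pos mean_nonneg[of "M r" "\<lambda>m. W (nxt r m)"] mean_nonneg[of "M r" "\<lambda>m. v (nxt r m)"]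
    by (intro add_pos_nonneg mult_nonneg_nonneg) (auto simp: W_nonneg v_nonneg)
  have l0: "0 < l0" using th_pos by (simp add: l0_def)
  have "mgf l n x \<le> exp (l * gain n r + c * l\<^sup>2 * real n) * (1 + l * (gain n x - gain n r) + l\<^sup>2 * (D * v x))"
    if l: "\<bar>l\<bar> \<le> l0" for l n x
  proof (induction n arbitrary: x)
    case 0
    show ?case using D v_nonneg[of x] by simp
  next
    case (Suc n)
    define b where "b = gain (Suc n) r - gain n r"
    define q where "q x = gain n x - gain n r" for x
    define E where "E = exp (l * gain n r + c * l\<^sup>2 * real n)"
    have l12: "\<bar>l\<bar> \<le> 1 / 2" using l by (simp add: l0_def)
    have "exp (2 * \<bar>l\<bar>) \<le> exp (ln (1 + th))"
      using l by (subst exp_le_cancel_iff) (simp add: l0_def)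
    then have lth: "exp (2 * \<bar>l\<bar>) \<le> 1 + th" using th_pos by simp
    let ?R = "4 + 6 * mean (M x) (\<lambda>m. W (nxt x m)) + D * (1 + th) * mean (M x) (\<lambda>m. v (nxt x m))"
    have "mgf l (Suc n) x \<le> mean (M x) (\<lambda>m. E * exp (l * b) *
        (1 + l * ((d x m - b) + q (nxt x m))
          + l\<^sup>2 * (4 + 6 * W (nxt x m) + D * (1 + th) * v (nxt x m))))"
      unfolding mgf.simps
    proof (rule mean_mono)
      fix m assume m: "m \<in> M x"
      have "exp (l * d x m) * mgf l n (nxt x m) \<le>
          exp (l * d x m) * (E * (1 + l * q (nxt x m) + l\<^sup>2 * (D * v (nxt x m))))"
        using Suc[of "nxt x m"] by (intro mult_left_mono) (auto simp: E_def q_def)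
      also have "\<dots> = E * exp (l * b) *
          (exp (l * (d x m - b)) * (1 + l * q (nxt x m) + l\<^sup>2 * (D * v (nxt x m))))"
        by (simp add: right_diff_distrib exp_diff)
      also have "\<dots> \<le> E * exp (l * b) * (1 + l * ((d x m - b) + q (nxt x m))
          + l\<^sup>2 * (4 + 6 * W (nxt x m) + D * (1 + th) * v (nxt x m)))"
      proof (intro mult_left_mono exp_tilt_le l12 lth v_nonneg)
        show "\<bar>d x m - b\<bar> \<le> 2" unfolding b_def by (rule abs_increment_le[OF m])
        show "\<bar>q (nxt x m)\<bar> \<le> W (nxt x m)" unfolding q_def by (rule gain_root_le)
      qed (use D in \<open>auto simp: E_def\<close>)
      finally show "exp (l * d x m) * mgf l n (nxt x m) \<le> \<dots>" .
    qed
    also have "\<dots> = E * exp (l * b) * (1 + l * (gain (Suc n) x - gain (Suc n) r) + l\<^sup>2 * ?R)"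
      unfolding gain_root_Suc[of n x] b_def q_def by (simp add: mean_cmult mean_add)
    also have "\<dots> \<le> E * exp (l * b) *
        (exp (c * l\<^sup>2) * (1 + l * (gain (Suc n) x - gain (Suc n) r) + l\<^sup>2 * (D * v x)))"
    proof (rule mult_left_mono)
      show "1 + l * (gain (Suc n) x - gain (Suc n) r) + l\<^sup>2 * ?R \<le>
        exp (c * l\<^sup>2) * (1 + l * (gain (Suc n) x - gain (Suc n) r) + l\<^sup>2 * (D * v x))"
      proof (cases "x = r")
        case True
        have "1 + l\<^sup>2 * c \<le> exp (c * l\<^sup>2)" using exp_ge_add_one_self[of "c * l\<^sup>2"] by (simp add: mult.commute)
        then show ?thesis using True by (simp add: c_def v_root)
      next
        case False
        \<comment> \<open>Completing the square, with \<open>p\<^sup>2 / 4 \<le> D * v x\<close>,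
          shows that the corrector is non-negative, so multiplying it by
          \<open>exp (c * l\<^sup>2)\<close> does not decrease it.\<close>
        define p where "p = gain (Suc n) x - gain (Suc n) r"
        have "p\<^sup>2 \<le> (W x)\<^sup>2" unfolding p_def using gain_root_le[of "Suc n" x]
          by (metis W_nonneg abs_le_square_iff abs_of_nonneg)
        also have "\<dots> \<le> B * v x" by (rule W_square_le)
        also have "\<dots> \<le> 4 * (D * v x)" using D v_nonneg[of x] mult_right_mono[of B "4 * D" "v x"] by simp
        finally have "l\<^sup>2 * (p\<^sup>2 / 4) \<le> l\<^sup>2 * (D * v x)" by (intro mult_left_mono) auto
        moreover have "0 \<le> (1 + l * p / 2)\<^sup>2" by simp
        ultimately have nn: "0 \<le> 1 + l * p + l\<^sup>2 * (D * v x)"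
          by (simp add: power2_sum power_mult_distrib power_divide)
        have "mean (M x) (\<lambda>m. W (nxt x m)) \<le> W x" using W_drift[OF False] by simp
        moreover have "D * (1 + th) * mean (M x) (\<lambda>m. v (nxt x m)) \<le> D * (1 + th) * ((1 - 2 * th) * v x)"
          using D th_pos v_drift[OF False] by (intro mult_left_mono) auto
        ultimately have "?R \<le> (4 + 6 * W x) + D * (1 + th) * ((1 - 2 * th) * v x)" by simp
        also have "4 + 6 * W x \<le> 6 * (B * v x)"
          using dominates[OF False] zero_le_power2[of "W x"] by linarith
        also have "6 * (B * v x) \<le> (D * th) * v x"
          using mult_right_mono[OF D(3) v_nonneg[of x]] by simp
        \<comment> \<open>The product of \<open>1 + th\<close> and \<open>1 - 2 * th\<close> is
          \<open>1 - th - 2 * th\<^sup>2\<close>; the lost \<open>D * th * v x\<close> has just paid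
          for \<open>4 + 6 * W x\<close>.\<close>
        also have "(D * th) * v x + D * (1 + th) * ((1 - 2 * th) * v x) = D * v x - 2 * D * th\<^sup>2 * v x"
          by (simp add: power2_eq_square algebra_simps)
        also have "\<dots> \<le> D * v x" using D v_nonneg[of x] by simp
        finally have "l\<^sup>2 * ?R \<le> l\<^sup>2 * (D * v x)" by (intro mult_left_mono) auto
        then have "1 + l * p + l\<^sup>2 * ?R \<le> 1 * (1 + l * p + l\<^sup>2 * (D * v x))" by simp
        also have "\<dots> \<le> exp (c * l\<^sup>2) * (1 + l * p + l\<^sup>2 * (D * v x))"
          using c nn by (intro mult_right_mono) auto
        finally show ?thesis by (simp add: p_def)
      qed
    qed (simp add: E_def)
    also have "\<dots> = exp (l * gain (Suc n) r + c * l\<^sup>2 * real (Suc n)) *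
        (1 + l * (gain (Suc n) x - gain (Suc n) r) + l\<^sup>2 * (D * v x))"
    proof -
      have "l * gain (Suc n) r + c * l\<^sup>2 * real (Suc n) =
          (l * gain n r + c * l\<^sup>2 * real n) + l * b + c * l\<^sup>2"
        by (simp add: b_def algebra_simps)
      then show ?thesis by (simp add: E_def exp_add mult.assoc)
    qed
    finally show ?case .
  qed
  with c D l0 that show thesis by blast
qed

end

section \<open>The number of plates and the olives on later plates\<close>

lemma moves_ConsE:
  assumes "m \<in> moves (k # zs)"
  obtains "m = Add_Plate"
  | j where "m = Merge 0 (Suc j)" "j < length zs"
  | i j where "m = Merge (Suc i) (Suc j)" "i < j" "j < length zs"
  | "m = Add_Olive 0"
  | i where "m = Add_Olive (Suc i)" "i < length zs"
  | "m = Remove_Olive 0" "0 < k"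
  | i where "m = Remove_Olive (Suc i)" "i < length zs" "0 < zs ! i"
proof -
  consider "m = Add_Plate" | i j where "m = Merge i j" "i < j" "j < Suc (length zs)"
    | i where "m = Add_Olive i" "i < Suc (length zs)"
    | i where "m = Remove_Olive i" "i < Suc (length zs)" "0 < (k # zs) ! i"
    using assms by (auto simp: moves_def)
  then show thesis
  proof cases
    case 1
    then show ?thesis by (rule that(1))
  next
    case (2 i j)
    then obtain j' where "j = Suc j'" by (cases j) auto
    then show ?thesis using 2 that(2,3) by (cases i) auto
  next
    case (3 i)
    then show ?thesis using that(4,5) by (cases i) auto
  next
    case (4 i)
    then show ?thesis using that(6,7) by (cases i) auto
  qed
qed

lemma perform_Merge_0: "perform (Merge 0 (Suc j)) (k # zs) = (k + zs ! j) # (take j zs @ drop (Suc j) zs)"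
  by simp

lemma perform_Merge_Suc: "perform (Merge (Suc i) (Suc j)) (k # zs) = k # perform (Merge i j) zs"
  by (simp add: Let_def)

definition others :: "table \<Rightarrow> nat" where
  "others xs = sum_list (tl xs)"

text \<open>A merger among later plates conserves their olives, and a merger into the first plate
  only takes olives away from them.\<close>

lemma others_perform_le:
  assumes "m \<in> moves xs"
  shows "others (perform m xs) \<le> others xs + 1"
proof (cases xs)
  case Nil
  then show ?thesis using assms by (simp add: moves_Nil others_def)
next
  case (Cons k zs)
  have del: "sum_list (take j zs) + sum_list (drop (Suc j) zs) \<le> sum_list zs" if "j < length zs" for j
    using sum_list_delete[OF that] by simp
  have rem: "sum_list (zs[i := zs ! i - Suc 0]) \<le> sum_list zs" if "i < length zs" for i
    using that elem_le_sum_list[of i zs] by (simp add: sum_list_update)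
  from assms[unfolded Cons] show ?thesis unfolding Cons
    by (cases rule: moves_ConsE)
      (auto simp: others_def perform_Merge_0 perform_Merge_Suc sum_list_merge sum_list_update
        simp del: perform.simps(2) dest: del rem intro: le_SucI)
qed

section \<open>Drift of the number of plates\<close>

definition merges :: "nat \<Rightarrow> real" where
  "merges n = real n * (real n - 1) / 2"

lemma card_moves_2: "length xs = 2 \<Longrightarrow> real (card (moves xs)) \<le> 6"
  using card_nonempty_plates[of xs] by (simp add: card_moves)

lemma merges_ge:
  assumes "3 \<le> n"
  shows "real n \<le> merges n" "3 \<le> merges n"
proof -
  have "real n * 2 \<le> real n * (real n - 1)" using assms by (intro mult_left_mono) auto
  then show "real n \<le> merges n" by (simp add: merges_def)
  then show "3 \<le> merges n" using assms by linarith
qed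

text \<open>From three plates on, mergers are at least as many as plates, so they form a fixed share
  of all moves. This fails at two plates, which are treated separately in the drift
  estimates.\<close>

lemma card_moves_3: "3 \<le> length xs \<Longrightarrow> real (card (moves xs)) \<le> 1 + 3 * merges (length xs)"
  using card_nonempty_plates[of xs] merges_ge[of "length xs"]
  unfolding card_moves merges_def by linarith

text \<open>With two plates a single merger competes with a single new plate. The offset 4 together
  with the drop to 0 makes the merger win there, by 8 against 4.\<close>

definition plate_v :: "nat \<Rightarrow> real" where
  "plate_v n = (if n \<le> 1 then 0 else 4 + 2 ^ n)"

definition plate_W :: "nat \<Rightarrow> real" where
  "plate_W n = (if n \<le> 1 then 0 else 10 * real n + 2)"

lemma plate_v_drift:
  assumes "2 \<le> length xs"
  shows "mean (moves xs) (\<lambda>m. plate_v (length (perform m xs))) \<le> (1 - 1 / 40) * plate_v (length xs)"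
proof -
  let ?n = "length xs"
  have "plate_v (Suc ?n) - plate_v ?n + merges ?n * (plate_v (?n - 1) - plate_v ?n)
    \<le> (- plate_v ?n / 40) * real (card (moves xs))"
  proof (cases "?n = 2")
    case True
    have "plate_v 2 / 40 * real (card (moves xs)) \<le> plate_v 2 / 40 * 6"
      using card_moves_2[OF True] by (intro mult_left_mono) (auto simp: plate_v_def)
    then show ?thesis by (simp add: True plate_v_def merges_def)
  next
    case False
    then obtain k where k: "?n = Suc k" "2 \<le> k" using assms by (cases ?n) auto
    have C: "3 \<le> merges ?n" using k by (intro merges_ge) simp
    have p: "(4::real) \<le> 2 ^ k" using power_increasing[OF k(2), of "2::real"] by simp
    have "plate_v ?n / 40 * real (card (moves xs)) \<le> (4 * 2 ^ k / 40) * (1 + 3 * merges ?n)"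
      using k p C by (intro mult_mono card_moves_3) (auto simp: plate_v_def)
    also have "\<dots> = 2 ^ k * ((1 + 3 * merges ?n) / 10)" by simp
    \<comment> \<open>With \<open>m\<close> mergers, \<open>(1 + 3 * m) / 10 \<le> m - 2\<close>
      holds exactly from \<open>m = 3\<close> on; this fixes the rate \<open>1 / 40\<close>.\<close>
    also have "\<dots> \<le> 2 ^ k * (merges ?n - 2)" using C by (intro mult_left_mono) auto
    finally have N: "plate_v ?n / 40 * real (card (moves xs)) \<le> 2 ^ k * (merges ?n - 2)" .
    have e: "plate_v (Suc ?n) - plate_v ?n = 2 * 2 ^ k" "plate_v (?n - 1) - plate_v ?n = - (2 ^ k)"
      using k by (auto simp: plate_v_def)
    show ?thesis unfolding e using N by (simp add: algebra_simps)
  qed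
  then have "mean (moves xs) (\<lambda>m. plate_v (length (perform m xs))) \<le> plate_v ?n + - plate_v ?n / 40"
    by (intro mean_moves_le) (simp add: sum_length_drift merges_def)
  then show ?thesis by simp
qed

text \<open>Slope 10 and offset 2 just suffice: at two plates the total is
  \<open>10 - 22 = - 2 * 6\<close>, and with \<open>m\<close> mergers
  \<open>10 - 10 * m \<le> - 2 * (1 + 3 * m)\<close> means \<open>3 \<le> m\<close>.\<close>

lemma plate_W_drift:
  assumes "2 \<le> length xs"
  shows "mean (moves xs) (\<lambda>m. plate_W (length (perform m xs))) \<le> plate_W (length xs) - 2"
proof -
  let ?n = "length xs"
  have "plate_W (Suc ?n) - plate_W ?n + merges ?n * (plate_W (?n - 1) - plate_W ?n)
    \<le> (- 2) * real (card (moves xs))"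
  proof (cases "?n = 2")
    case True
    show ?thesis using card_moves_2[OF True] by (simp add: True plate_W_def merges_def)
  next
    case False
    then obtain k where k: "?n = Suc k" "2 \<le> k" using assms by (cases ?n) auto
    have C: "3 \<le> merges ?n" using k by (intro merges_ge) simp
    have "real (card (moves xs)) \<le> 1 + 3 * merges ?n" using k by (intro card_moves_3) simp
    then show ?thesis using k C by (simp add: plate_W_def algebra_simps)
  qed
  then show ?thesis
    using mean_moves_le[where f = "\<lambda>m. plate_W (length (perform m xs))" and xs = xs
        and c = "plate_W ?n" and e = "-2"]
    by (simp add: sum_length_drift merges_def)
qed

text \<open>
  Other plates hold olives only while there are at least two plates, and then \<open>plate_v\<close> contracts
  faster than the factor \<open>exp (ln (91 / 90) * others xs)\<close> can grow.
\<close>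

definition spill :: "table \<Rightarrow> real" where
  "spill xs = (91 / 90) ^ others xs * (plate_v (length xs) + 1)"

lemma plate_v_nonneg: "0 \<le> plate_v n"
  by (simp add: plate_v_def)

lemma spill_nonneg: "0 \<le> spill xs"
  using plate_v_nonneg[of "length xs"] by (simp add: spill_def)

lemma spill_drift: "mean (moves xs) (\<lambda>m. spill (perform m xs)) \<le> 89 / 90 * spill xs + 9"
proof (cases "length xs \<le> 1")
  case True
  \<comment> \<open>After such a move the later plates hold nothing and there are at most two
    plates, so the value is at most \<open>plate_v 2 + 1\<close>.\<close>
  have "spill (perform m xs) \<le> 9" if m: "m \<in> moves xs" for m
  proof (cases xs)
    case Nil
    then show ?thesis using m by (simp add: moves_Nil spill_def others_def plate_v_def)
  next
    case (Cons k zs)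
    then have "zs = []" using True by simp
    from m[unfolded Cons this] show ?thesis unfolding Cons \<open>zs = []\<close>
      by (cases rule: moves_ConsE) (auto simp: spill_def others_def plate_v_def)
  qed
  then have "mean (moves xs) (\<lambda>m. spill (perform m xs)) \<le> mean (moves xs) (\<lambda>_. 9)"
    by (rule mean_mono)
  then show ?thesis using spill_nonneg[of xs] by simp
next
  case False
  let ?v = "plate_v (length xs)"
  define a :: real where "a = 91 / 90"
  have v8: "8 \<le> ?v"
    using False power_increasing[of 2 "length xs" "2::real"] by (simp add: plate_v_def)
  have "mean (moves xs) (\<lambda>m. spill (perform m xs)) \<le>
      mean (moves xs) (\<lambda>m. (a ^ others xs * a) * (plate_v (length (perform m xs)) + 1))"
  proof (rule mean_mono)
    fix m assume "m \<in> moves xs"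
    then have "a ^ others (perform m xs) \<le> a ^ (others xs + 1)"
      by (intro power_increasing others_perform_le) (auto simp: a_def)
    then show "spill (perform m xs) \<le> (a ^ others xs * a) * (plate_v (length (perform m xs)) + 1)"
      unfolding spill_def a_def[symmetric]
      by (intro mult_right_mono) (auto simp: plate_v_nonneg mult.commute add_nonneg_nonneg)
  qed
  also have "\<dots> = (a ^ others xs * a) * (mean (moves xs) (\<lambda>m. plate_v (length (perform m xs))) + 1)"
    by (simp add: mean_cmult mean_add)
  also have "\<dots> \<le> (a ^ others xs * a) * ((1 - 1 / 40) * ?v + 1)"
    using False by (intro mult_left_mono add_right_mono plate_v_drift) (auto simp: a_def)
  also have "\<dots> = a ^ others xs * (a * ((1 - 1 / 40) * ?v + 1))"
    by simp
  \<comment> \<open>Multiplied by 90 this reads \<open>88.725 * v + 91 \<le> 89 * v + 89\<close>,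
    true for \<open>v \<ge> 8\<close>.\<close>
  also have "\<dots> \<le> a ^ others xs * (89 / 90 * (?v + 1))"
    using v8 by (intro mult_left_mono) (auto simp: a_def)
  also have "\<dots> = 89 / 90 * spill xs" by (simp add: spill_def a_def)
  finally show ?thesis by linarith
qed

text \<open>810 is the fixed point of the map \<open>z \<mapsto> 89 / 90 * z + 9\<close> from the
  drift estimate, so the bound is uniform in time.\<close>

lemma expectation_spill_le: "measure_pmf.expectation (law t) spill \<le> 810"
proof (induction t)
  case 0
  show ?case by (simp add: law_0 spill_def others_def plate_v_def)
next
  case (Suc t)
  have "measure_pmf.expectation (law (Suc t)) spill \<le>
      measure_pmf.expectation (law t) (\<lambda>x. 89 / 90 * spill x + 9)"
    unfolding expectation_law_Suc by (intro expectation_law_mono spill_drift)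
  also have "\<dots> = 89 / 90 * measure_pmf.expectation (law t) spill + 9"
    by simp
  finally show ?case using Suc by simp
qed

section \<open>Logarithmic bound on the later plates\<close>

theorem small_plates:
  "\<exists>B :: real. B > 0 \<and>
    ((\<lambda>t :: nat. measure_pmf.prob (game t)
      {h. \<forall>s \<le> t. \<forall>i. 1 \<le> i \<and> i < length (h ! s) \<longrightarrow> real (h ! s ! i) \<le> B * ln (real t)})
      \<longlonglongrightarrow> 1)"
proof -
  define a where "a = ln (91 / 90 :: real)"
  \<comment> \<open>Then \<open>exp (a * (B * ln t))\<close> is \<open>t\<^sup>2\<close>, so the
    failure probability at one time is \<open>O(1 / t\<^sup>2)\<close>, which survives a union bound
    over \<open>t + 1\<close> times.\<close>
  define B where "B = 2 / a"
  have a: "0 < a" by (simp add: a_def)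
  define S where "S t = {h. \<forall>s \<le> t. \<forall>i. 1 \<le> i \<and> i < length (h ! s) \<longrightarrow>
    real (h ! s ! i) \<le> B * ln (real t)}" for t :: nat
  have bad: "measure_pmf.prob (game t) (- S t) \<le> real (Suc t) * (810 / (real t)\<^sup>2)" if t: "1 \<le> t" for t
  proof -
    have one: "measure_pmf.prob (game t) {h. B * ln (real t) < real (others (h ! s))} \<le> 810 / (real t)\<^sup>2"
      if "s \<le> t" for s
    proof -
      have "measure_pmf.prob (game t) {h. B * ln (real t) < real (others (h ! s))} =
          measure_pmf.prob (law s) {x. B * ln (real t) < real (others x)}"
        by (rule prob_game_law[OF that])
      also have "\<dots> \<le> measure_pmf.expectation (law s) spill / (real t)\<^sup>2"
      proof (rule prob_law_le)
        fix x assume "B * ln (real t) < real (others x)"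
        then have "2 * ln (real t) \<le> a * real (others x)"
          using a by (simp add: B_def field_simps)
        then have "exp (2 * ln (real t)) \<le> exp (a * real (others x))" by simp
        also have "exp (2 * ln (real t)) = (real t)\<^sup>2"
          using t by (simp add: exp_double)
        also have "exp (a * real (others x)) = (91 / 90) ^ others x"
          by (simp add: a_def exp_of_nat2_mult)
        also have "\<dots> \<le> spill x" using plate_v_nonneg[of "length x"] by (simp add: spill_def)
        finally show "(real t)\<^sup>2 \<le> spill x" .
      qed (use t in \<open>auto simp: spill_nonneg\<close>)
      also have "\<dots> \<le> 810 / (real t)\<^sup>2"
        by (intro divide_right_mono expectation_spill_le) simp
      finally show ?thesis .
    qed
    have elem: "h ! s ! i \<le> others (h ! s)" if "1 \<le> i" "i < length (h ! s)" for h :: "table list" and s i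
    proof -
      have "h ! s ! i = tl (h ! s) ! (i - 1)" using that by (simp add: nth_tl)
      also have "\<dots> \<le> others (h ! s)" unfolding others_def using that by (intro elem_le_sum_list) simp
      finally show ?thesis .
    qed
    have "- S t \<subseteq> (\<Union>s\<in>{..t}. {h. B * ln (real t) < real (others (h ! s))})"
    proof
      fix h assume "h \<in> - S t"
      then obtain s i where s: "s \<le> t" "1 \<le> i" "i < length (h ! s)" "B * ln (real t) < real (h ! s ! i)"
        by (auto simp: S_def not_le)
      then have "B * ln (real t) < real (others (h ! s))" using elem[OF s(2,3)] by linarith
      then show "h \<in> (\<Union>s\<in>{..t}. {h. B * ln (real t) < real (others (h ! s))})" using s by auto
    qed
    then have "measure_pmf.prob (game t) (- S t) \<le>
        measure_pmf.prob (game t) (\<Union>s\<in>{..t}. {h. B * ln (real t) < real (others (h ! s))})"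
      by (intro measure_pmf.finite_measure_mono) auto
    also have "\<dots> \<le> (\<Sum>s\<le>t. measure_pmf.prob (game t) {h. B * ln (real t) < real (others (h ! s))})"
      by (intro measure_pmf.finite_measure_subadditive_finite) auto
    also have "\<dots> \<le> (\<Sum>s\<le>t. 810 / (real t)\<^sup>2)"
      by (intro sum_mono one) simp
    finally show ?thesis by simp
  qed
  have lim: "(\<lambda>t. 1 - real (Suc t) * (810 / (real t)\<^sup>2)) \<longlonglongrightarrow> 1"
    by real_asymp
  have "(\<lambda>t. measure_pmf.prob (game t) (S t)) \<longlonglongrightarrow> 1"
  proof (rule tendsto_sandwich[OF _ _ lim tendsto_const])
    show "\<forall>\<^sub>F t in sequentially. 1 - real (Suc t) * (810 / (real t)\<^sup>2) \<le> measure_pmf.prob (game t) (S t)"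
      using eventually_ge_at_top[of 1]
    proof eventually_elim
      case (elim t)
      have "measure_pmf.prob (game t) (- S t) = 1 - measure_pmf.prob (game t) (S t)"
        using measure_pmf.prob_compl[of "S t" "game t"] by (simp add: Compl_eq_Diff_UNIV)
      with bad[OF elim] show ?case by simp
    qed
  qed (auto intro: always_eventually)
  moreover have "0 < B" using a by (simp add: B_def)
  ultimately show ?thesis unfolding S_def by blast
qed

section \<open>The content of the first plate\<close>

text \<open>
  The weights are chosen so that the drift of \<open>first_potential\<close> is at least \<open>1/5\<close> in every
  configuration; since an olive on the first plate weighs \<open>20\<close>, this is a speed of
  \<open>1/100 > 1/342\<close>. In a merger with the first plate, only one olive of the other plate is
  taken into account by \<open>step_bound\<close>, which keeps it bounded.
\<close>

definition others_potential :: "table \<Rightarrow> real" where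
  "others_potential zs = (if zs = [] then 0
    else 5 - 4 * real (length zs) + (if 0 < sum_list zs then 6 else 0))"

definition first_potential :: "table \<Rightarrow> real" where
  "first_potential xs = 20 * real (hd xs) + others_potential (tl xs)"

definition step_bound :: "table \<Rightarrow> move \<Rightarrow> real" where
  "step_bound zs m = (case m of
      Add_Plate \<Rightarrow> if zs = [] then 1 else -4
    | Merge i j \<Rightarrow> if length zs = 1 then if 0 < sum_list zs then 13 else -1 else 4
    | Add_Olive i \<Rightarrow> if i = 0 then 20 else if sum_list zs = 0 then 6 else 0
    | Remove_Olive i \<Rightarrow> if i = 0 then -20 else if sum_list zs = 1 then -6 else 0)"

lemma abs_step_bound_le: "\<bar>step_bound zs m\<bar> \<le> 20"
  by (cases m) (simp_all add: step_bound_def)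

text \<open>The bonus 6 for olives on later plates is lost in a merger only if olives reach the
  first plate, where each is worth 20, and in a removal only if the last such olive goes. Merging
  away the only later plate costs 7 or 1 and gains 20 per olive moved.\<close>

lemma step_bound_le:
  assumes "m \<in> moves (k # zs)"
  shows "step_bound zs m \<le> first_potential (perform m (k # zs)) - first_potential (k # zs)"
  using assms
proof (cases rule: moves_ConsE)
  case 1
  then show ?thesis by (simp add: step_bound_def first_potential_def others_potential_def)
next
  case (2 j)
  define ys where "ys = take j zs @ drop (Suc j) zs"
  have s: "sum_list ys + zs ! j = sum_list zs" unfolding ys_def using 2 by (intro sum_list_delete)
  have l: "length ys = length zs - 1" using 2 by (simp add: ys_def)
  show ?thesis
  proof (cases "length zs = 1")
    case True
    then obtain a where "zs = [a]" by (cases zs) auto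
    then show ?thesis using 2 by (auto simp: step_bound_def first_potential_def others_potential_def)
  next
    case False
    then have l2: "2 \<le> length zs" using 2 by linarith
    then have "ys \<noteq> []" "zs \<noteq> []" using l by auto
    then have "first_potential (perform m (k # zs)) - first_potential (k # zs) =
        20 * real (zs ! j) + 4 + ((if 0 < sum_list ys then 6 else 0) - (if 0 < sum_list zs then 6 else 0))"
      using l l2 unfolding 2(1) perform_Merge_0 ys_def[symmetric]
      by (simp add: first_potential_def others_potential_def of_nat_diff)
    moreover have "zs ! j = 0 \<Longrightarrow> sum_list ys = sum_list zs" using s by simp
    ultimately show ?thesis using 2 False
      by (cases "zs ! j = 0") (auto simp: step_bound_def)
  qed
next
  case (3 i j)
  have m: "Merge i j \<in> moves zs" using 3 by (simp add: moves_def)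
  have l: "length (perform (Merge i j) zs) = length zs - 1" using length_perform[OF m] by simp
  have "2 \<le> length zs" using 3 by linarith
  moreover from this l have "perform (Merge i j) zs \<noteq> []" "zs \<noteq> []" by (auto simp del: perform.simps)
  ultimately show ?thesis using 3 l unfolding 3(1) perform_Merge_Suc
    by (simp add: step_bound_def first_potential_def others_potential_def sum_list_merge of_nat_diff
        del: perform.simps)
next
  case 4
  then show ?thesis by (simp add: step_bound_def first_potential_def)
next
  case (5 i)
  then have "zs \<noteq> []" by auto
  with 5 show ?thesis
    by (auto simp: step_bound_def first_potential_def others_potential_def sum_list_update
        simp del: sum_list_eq_0_iff)
next
  case 6
  then show ?thesis by (simp add: step_bound_def first_potential_def of_nat_diff)
next
  case (7 i)
  have "zs ! i \<le> sum_list zs" using 7 by (intro elem_le_sum_list)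
  then have s: "sum_list (zs[i := zs ! i - 1]) = sum_list zs - 1" "0 < sum_list zs"
    using 7 by (auto simp: sum_list_update)
  have "zs \<noteq> []" using 7 by auto
  with 7 s show ?thesis
    by (simp add: step_bound_def first_potential_def others_potential_def)
qed


section \<open>Drift of the first-plate potential\<close>

definition nonempty_plates :: "table \<Rightarrow> nat" where
  "nonempty_plates xs = card {i. i < length xs \<and> 0 < xs ! i}"

lemma nonempty_indices_Cons:
  "{i. i < length (k # zs) \<and> 0 < (k # zs) ! i} =
    (if 0 < k then {0} else {}) \<union> Suc ` {i. i < length zs \<and> 0 < zs ! i}"
proof (rule set_eqI)
  fix i
  show "i \<in> {i. i < length (k # zs) \<and> 0 < (k # zs) ! i} \<longleftrightarrow>
      i \<in> (if 0 < k then {0} else {}) \<union> Suc ` {i. i < length zs \<and> 0 < zs ! i}"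
    by (cases i) auto
qed

lemma sum_nonempty_Cons:
  fixes f :: "nat \<Rightarrow> real"
  shows "(\<Sum>i | i < length (k # zs) \<and> 0 < (k # zs) ! i. f i) =
    (if 0 < k then f 0 else 0) + (\<Sum>i | i < length zs \<and> 0 < zs ! i. f (Suc i))"
  unfolding nonempty_indices_Cons
  by (subst sum.union_disjoint) (auto simp: sum.reindex)

lemma nonempty_plates_le_sum: "nonempty_plates zs \<le> sum_list zs"
proof -
  have "nonempty_plates zs \<le> (\<Sum>i | i < length zs \<and> 0 < zs ! i. zs ! i)"
    unfolding nonempty_plates_def card_eq_sum by (rule sum_mono) auto
  also have "\<dots> \<le> (\<Sum>i<length zs. zs ! i)" by (rule sum_mono2) auto
  finally show ?thesis by (simp add: sum_list_sum_nth atLeast0LessThan)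
qed

text \<open>The rate \<open>1 / 5\<close> is attained with a non-empty first plate and one empty
  later plate: total 1 over 5 moves. From three plates on, with \<open>m\<close> mergers, the total
  is at least \<open>4 * m - 10\<close> and the number of moves at most \<open>1 + 3 * m\<close>,
  which suffices for \<open>m \<ge> 3\<close>.\<close>

lemma sum_step_bound:
  "real (card (moves (k # zs))) / 5 \<le> (\<Sum>m\<in>moves (k # zs). step_bound zs m)"
proof -
  let ?n = "length zs" and ?c = "real (nonempty_plates zs)"
  define D where "D = (if sum_list zs = 1 then -6 else 0 :: real)"
  define A where "A = (if sum_list zs = 0 then 6 else 0 :: real)"
  define G where "G = (if length zs = 1 then if 0 < sum_list zs then 13 else -1 else 4 :: real)"
  have N: "real (card (moves (k # zs))) =
      1 + merges (Suc ?n) + real (Suc ?n) + ((if 0 < k then 1 else 0) + ?c)"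
    using sum_nonempty_Cons[where k = k and zs = zs and f = "\<lambda>_. 1"]
    by (simp add: card_moves merges_def nonempty_plates_def)
  have S: "(\<Sum>m\<in>moves (k # zs). step_bound zs m) = (if zs = [] then 1 else -4) +
      merges (Suc ?n) * G + (20 + real ?n * A) + ((if 0 < k then -20 else 0) + ?c * D)"
    unfolding sum_moves sum_nonempty_Cons
    by (simp add: step_bound_def split_def card_pairs merges_def sum.lessThan_Suc_shift
        nonempty_plates_def A_def D_def G_def del: sum.lessThan_Suc)
  have c_sum: "?c \<le> real (sum_list zs)" using nonempty_plates_le_sum[of zs] by simp
  have c_len: "?c \<le> real ?n"
    using card_nonempty_plates[of zs] by (simp add: nonempty_plates_def)
  \<comment> \<open>\<open>D\<close> is non-zero only if the later plates hold exactly one olive,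
    and then at most one of them is non-empty.\<close>
  have cD: "-6 \<le> ?c * D" "0 < sum_list zs \<or> ?c * D = 0"
    using c_sum by (auto simp: D_def)
  consider "zs = []" | a where "zs = [a]" | "2 \<le> ?n"
    by (cases zs; cases "tl zs") auto
  then show ?thesis
  proof cases
    case 1
    then show ?thesis using c_len unfolding S N by (simp add: merges_def D_def)
  next
    case (2 a)
    then show ?thesis using c_len c_sum cD unfolding S N
      by (auto simp: merges_def A_def G_def)
  next
    case 3
    have "3 \<le> Suc ?n" using 3 by simp
    note C = merges_ge[OF this]
    have "0 \<le> real ?n * A" by (simp add: A_def)
    moreover have "G = 4" "zs \<noteq> []" using 3 by (auto simp: G_def)
    ultimately show ?thesis using C c_len cD(1) unfolding S N by simp
  qed
qed

text \<open>Only lower bounds on the increments enter, so arbitrarily large mergers are harmless. At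
  scale \<open>1 / 4000\<close> the second-order loss \<open>400 / 4000\<^sup>2 = 1 / 40000\<close>
  is half of the first-order gain \<open>1 / 20000\<close>.\<close>

lemma exp_potential_drift:
  assumes "xs \<noteq> []"
  shows "mean (moves xs) (\<lambda>m. exp (- first_potential (perform m xs) / 4000))
    \<le> exp (- 1 / 40000) * exp (- first_potential xs / 4000)"
proof -
  obtain k zs where xs: "xs = k # zs" using assms by (cases xs) auto
  let ?e = "exp (- first_potential xs / 4000)" and ?D = "step_bound zs"
  have "mean (moves xs) (\<lambda>m. exp (- first_potential (perform m xs) / 4000)) \<le>
      mean (moves xs) (\<lambda>m. ?e * (1 + 400 / 4000\<^sup>2 + (- 1 / 4000) * ?D m))"
  proof (rule mean_mono)
    fix m assume m: "m \<in> moves xs"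
    have "- first_potential (perform m xs) / 4000 \<le> - first_potential xs / 4000 + (- ?D m / 4000)"
      using step_bound_le[OF m[unfolded xs]] unfolding xs by simp
    then have "exp (- first_potential (perform m xs) / 4000) \<le> ?e * exp (- ?D m / 4000)"
      by (simp flip: exp_add)
    also have "exp (- ?D m / 4000) \<le> 1 + (- ?D m / 4000) + (- ?D m / 4000)\<^sup>2"
      using abs_step_bound_le[of zs m] by (intro exp_le_quadratic) simp
    also have "(- ?D m / 4000)\<^sup>2 \<le> 400 / 4000\<^sup>2"
    proof -
      have "(?D m)\<^sup>2 \<le> 20\<^sup>2" using abs_step_bound_le[of zs m] abs_le_square_iff[of "?D m" 20] by simp
      then show ?thesis by (simp add: power_divide)
    qed
    finally show "exp (- first_potential (perform m xs) / 4000) \<le> ?e * (1 + 400 / 4000\<^sup>2 + (- 1 / 4000) * ?D m)"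
      by (simp add: algebra_simps)
  qed
  also have "\<dots> = ?e * (1 + 400 / 4000\<^sup>2 + (- 1 / 4000) * mean (moves xs) ?D)"
    unfolding mean_cmult mean_add by simp
  also have "\<dots> \<le> ?e * (1 + 400 / 4000\<^sup>2 + (- 1 / 4000) * (1 / 5))"
  proof -
    have "1 / 5 \<le> mean (moves xs) ?D"
      using sum_step_bound[of k zs] card_moves_pos[of xs] unfolding mean_def xs
      by (simp add: le_divide_eq)
    then show ?thesis by (intro mult_left_mono) auto
  qed
  also have "\<dots> \<le> ?e * exp (- 1 / 40000)"
    using exp_ge_add_one_self[of "- 1 / 40000"] by (intro mult_left_mono) (auto simp: power2_eq_square)
  finally show ?thesis by (simp add: mult.commute)
qed

section \<open>Lower tail of the content of the first plate\<close>

lemma expectation_exp_potential: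
  "measure_pmf.expectation (law (Suc t)) (\<lambda>x. exp (- first_potential x / 4000)) \<le> exp (- real t / 40000)"
proof (induction t)
  case 0
  show ?case by (simp add: expectation_law_1 first_potential_def others_potential_def)
next
  case (Suc t)
  have "measure_pmf.expectation (law (Suc (Suc t))) (\<lambda>x. exp (- first_potential x / 4000)) \<le>
     measure_pmf.expectation (law (Suc t)) (\<lambda>x. exp (- 1 / 40000) * exp (- first_potential x / 4000))"
    unfolding expectation_law_Suc[of "Suc t"]
    by (intro expectation_law_mono exp_potential_drift law_nonempty)
  also have "\<dots> \<le> exp (- 1 / 40000) * exp (- real t / 40000)"
    using Suc by simp
  also have "\<dots> = exp (- real (Suc t) / 40000)"
    by (simp flip: exp_add add: field_simps)
  finally show ?case .
qed

lemma prob_first_plate_small: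
  assumes "1 \<le> t"
  shows "measure_pmf.prob (law t) {x. real (hd x) \<le> real t / 342} \<le> exp (1 - real t / 100000)"
proof -
  obtain s where t: "t = Suc s" using assms by (cases t) auto
  \<comment> \<open>7 is the maximum of \<open>others_potential\<close>, attained at one non-empty
    later plate.\<close>
  define b where "b = (20 * real t / 342 + 7) / 4000"
  have "measure_pmf.prob (law t) {x. real (hd x) \<le> real t / 342} \<le>
      measure_pmf.expectation (law t) (\<lambda>x. exp (- first_potential x / 4000)) / exp (- b)"
  proof (rule prob_law_le)
    fix x :: table assume "real (hd x) \<le> real t / 342"
    moreover have "others_potential (tl x) \<le> 7"
      by (cases "tl x") (auto simp: others_potential_def)
    ultimately have "first_potential x \<le> 20 * real t / 342 + 7"
      by (simp add: first_potential_def)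
    then show "exp (- b) \<le> exp (- first_potential x / 4000)" by (simp add: b_def)
  qed auto
  also have "\<dots> \<le> exp (- real s / 40000) / exp (- b)"
    unfolding t by (intro divide_right_mono expectation_exp_potential) simp
  also have "\<dots> = exp (- real s / 40000 + b)"
    by (subst exp_diff[symmetric]) simp
  \<comment> \<open>The threshold costs \<open>20 / (342 * 4000)\<close> per move, less than
    \<open>3 / 200000\<close>; of the rate \<open>1 / 40000\<close> more than
    \<open>1 / 100000\<close> is left.\<close>
  also have "\<dots> \<le> exp (1 - real t / 100000)"
    by (simp add: b_def t add_divide_distrib)
  finally show ?thesis .
qed

section \<open>Upper tail of the number of olives\<close>

lemma hd_le_olives: "x \<noteq> [] \<Longrightarrow> real (hd x) \<le> olives x"
  by (cases x) (auto simp: olives_def)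

text \<open>An added olive doubles the weight and has conditional probability at most
  \<open>1 / 2\<close>; no other move increases the weight. Hence a factor \<open>3 / 2\<close> per
  move.\<close>

lemma expectation_two_power:
  "measure_pmf.expectation (law t) (\<lambda>x. 2 powr olives x) \<le> (3 / 2) ^ t"
proof (induction t)
  case 0
  show ?case by (simp add: law_0 olives_def)
next
  case (Suc t)
  have "mean (moves x) (\<lambda>m. 2 powr olives (perform m x)) \<le> 3 / 2 * 2 powr olives x" for x
  proof -
    have "mean (moves x) (\<lambda>m. 2 powr olives (perform m x)) \<le>
      mean (moves x) (\<lambda>m. 2 powr olives x * (1 + (case m of Add_Olive _ \<Rightarrow> 1 | _ \<Rightarrow> 0)))"
    proof (rule mean_mono)
      fix m assume m: "m \<in> moves x"
      have "olives (perform m x) = olives x + (case m of Add_Olive _ \<Rightarrow> 1 | Remove_Olive _ \<Rightarrow> -1 | _ \<Rightarrow> 0)"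
        using olives_perform[OF m] by simp
      then show "2 powr olives (perform m x) \<le> 2 powr olives x * (1 + (case m of Add_Olive _ \<Rightarrow> 1 | _ \<Rightarrow> 0))"
        by (auto simp: powr_add powr_diff split: move.splits)
    qed
    also have "\<dots> = 2 powr olives x * (1 + mean (moves x) (\<lambda>m. case m of Add_Olive _ \<Rightarrow> 1 | _ \<Rightarrow> 0))"
      unfolding mean_cmult mean_add by simp
    also have "mean (moves x) (\<lambda>m. case m of Add_Olive _ \<Rightarrow> 1 | _ \<Rightarrow> 0) = real (length x) / real (card (moves x))"
      unfolding mean_def sum_moves by (simp add: split_def)
    also have "\<dots> \<le> 1 / 2"
    proof -
      \<comment> \<open>With \<open>n\<close> plates, \<open>1 + n * (n - 1) / 2 + n\<close> exceeds
        \<open>2 * n\<close> by half this product, which is non-negative at integers.\<close>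
      have "0 \<le> (real (length x) - 1) * (real (length x) - 2)"
      proof (cases "length x \<le> 1")
        case True
        then show ?thesis by (intro mult_nonpos_nonpos) auto
      next
        case False
        then show ?thesis by (intro mult_nonneg_nonneg) auto
      qed
      then have "2 * real (length x) \<le> real (card (moves x))"
        unfolding card_moves by (simp add: field_simps)
      then show ?thesis using card_moves_pos[of x] by (simp add: divide_le_eq)
    qed
    finally show ?thesis by simp
  qed
  then have "measure_pmf.expectation (law (Suc t)) (\<lambda>x. 2 powr olives x) \<le>
      measure_pmf.expectation (law t) (\<lambda>x. 3 / 2 * 2 powr olives x)"
    unfolding expectation_law_Suc by (intro expectation_law_mono)
  then show ?case using Suc by simp
qed

lemma prob_many_olives:
  "measure_pmf.prob (law t) {x. 2 / 3 * real t < olives x}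
    \<le> exp (- (2 / 3 * ln 2 - ln (3 / 2)) * real t)"
proof -
  have "measure_pmf.prob (law t) {x. 2 / 3 * real t < olives x} \<le>
      measure_pmf.expectation (law t) (\<lambda>x. 2 powr olives x) / 2 powr (2 / 3 * real t)"
    by (rule prob_law_le) auto
  also have "\<dots> \<le> (3 / 2) ^ t / 2 powr (2 / 3 * real t)"
    by (intro divide_right_mono expectation_two_power) simp
  also have "(3 / 2 :: real) ^ t = exp (ln (3 / 2) * real t)"
    by (simp add: exp_of_nat2_mult)
  also have "exp (ln (3 / 2) * real t) / 2 powr (2 / 3 * real t) =
      exp (- (2 / 3 * ln 2 - ln (3 / 2)) * real t)"
    by (simp add: powr_def algebra_simps flip: exp_diff)
  finally show ?thesis .
qed

section \<open>Small times and removal of the prefactor\<close>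

lemma law_step: "x \<in> set_pmf (law t) \<Longrightarrow> m \<in> moves x \<Longrightarrow> perform m x \<in> set_pmf (law (Suc t))"
  by (auto simp: set_law_Suc)

lemma single_plate_reachable: "[a] \<in> set_pmf (law (Suc a))"
proof (induction a)
  case 0
  show ?case by (simp add: set_law_Suc law_0 moves_Nil)
next
  case (Suc a)
  show ?case using law_step[OF Suc, of "Add_Olive 0"] by (simp add: moves_def)
qed

lemma plates_reachable: "a # replicate b 0 \<in> set_pmf (law (Suc a + b))"
proof (induction b)
  case 0
  show ?case using single_plate_reachable[of a] by simp
next
  case (Suc b)
  show ?case using law_step[OF Suc, of Add_Plate] by (simp add: moves_def replicate_append_same)
qed

text \<open>For small times the exponential tail bound may be vacuous and positivity has to replace
  it. The witness puts about \<open>t / 2\<close> olives on the first plate and spends the other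
  moves on empty plates. At \<open>t = 1\<close> the only table is \<open>[0]\<close>, which lies
  outside the range.\<close>

lemma prob_olives_pos:
  assumes "2 \<le> t"
  shows "0 < measure_pmf.prob (law t) {x. 1 / 342 * real t \<le> olives x \<and> olives x \<le> 2 / 3 * real t}"
proof -
  define a where "a = t div 2"
  define x where "x = a # replicate (t - Suc a) 0"
  have "t = Suc a + (t - Suc a)" using assms by (simp add: a_def)
  then have x: "x \<in> set_pmf (law t)" using plates_reachable[of a "t - Suc a"] by (simp add: x_def)
  have "olives x = real a" by (simp add: x_def olives_def sum_list_replicate)
  moreover have "t \<le> 4 * a" "2 * a \<le> t" using assms by (auto simp: a_def)
  then have "real t \<le> 4 * real a" "2 * real a \<le> real t" by linarith+
  ultimately have "1 / 342 * real t \<le> olives x \<and> olives x \<le> 2 / 3 * real t" by simp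
  with x show ?thesis by (auto intro!: measure_pmf_posI)
qed

text \<open>For large \<open>t\<close> half of the exponent absorbs \<open>K\<close>. For the
  finitely many others \<open>C * t \<le> p t\<close> is enough, since
  \<open>1 - exp (- C * t) \<le> C * t\<close>; at \<open>t = 0\<close> the left side
  vanishes.\<close>

lemma exponential_rate_uniform:
  fixes p :: "nat \<Rightarrow> real"
  assumes tail: "\<And>t. 1 \<le> t \<Longrightarrow> 1 - K * exp (- a * real t) \<le> p t" and a: "0 < a" and K: "1 \<le> K"
    and pos: "\<And>t. 2 \<le> t \<Longrightarrow> 0 < p t" and nonneg: "0 \<le> p 0"
  shows "\<exists>C>0. \<forall>t. t \<noteq> 1 \<longrightarrow> 1 - exp (- C * real t) \<le> p t"
proof -
  obtain t0 :: nat where t0: "2 * ln K / a < real t0" using reals_Archimedean2 by blast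
  define C where "C = Min (insert (a / 2) ((\<lambda>t. p t / real t) ` {2..t0}))"
  have C: "0 < C" unfolding C_def using a pos by (subst Min_gr_iff) auto
  have C2: "C \<le> a / 2" unfolding C_def by (rule Min_le) auto
  have "1 - exp (- C * real t) \<le> p t" if "t \<noteq> 1" for t
  proof (cases "t \<le> t0")
    case True
    show ?thesis
    proof (cases "t = 0")
      case False
      then have t: "t \<in> {2..t0}" using True that by auto
      have "C \<le> p t / real t" unfolding C_def by (rule Min_le) (use t in auto)
      then have "C * real t \<le> p t" using False by (simp add: field_simps)
      then show ?thesis using exp_ge_add_one_self[of "- C * real t"] by simp
    qed (use nonneg in simp)
  next
    case False
    then have t: "t0 < t" by simp
    have "2 * ln K / a < real t" using t0 t by linarith
    then have lK: "ln K \<le> a / 2 * real t" using a by (simp add: field_simps)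
    have "K * exp (- a * real t) = exp (ln K + - a * real t)" using K by (simp only: exp_add exp_ln)
    also have "\<dots> \<le> exp (- C * real t)"
      using lK mult_right_mono[OF C2, of "real t"] by simp
    finally show ?thesis using tail[of t] t by simp
  qed
  with C show ?thesis by blast
qed

theorem linear_olives:
  "\<exists>C>0. \<forall>t. t \<noteq> 1 \<longrightarrow> 1 - exp (- C * real t) \<le>
    measure_pmf.prob (law t) {x. 1 / 342 * real t \<le> olives x \<and> olives x \<le> 2 / 3 * real t}"
proof -
  define c where "c = 2 / 3 * ln 2 - ln (3 / 2 :: real)"
  define a where "a = min c (1 / 100000)"
  let ?G = "\<lambda>t. {x. 1 / 342 * real t \<le> olives x \<and> olives x \<le> 2 / 3 * real t}"
  \<comment> \<open>\<open>27 / 8 < 4\<close> is exactly the positivity of the rate at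
    \<open>2 / 3\<close>.\<close>
  have "ln ((3 / 2 :: real) ^ 3) < ln (2 ^ 2)" by (subst ln_less_cancel_iff) (auto simp: power3_eq_cube)
  moreover have "ln ((3 / 2 :: real) ^ 3) = 3 * ln (3 / 2)" "ln (2 ^ 2 :: real) = 2 * ln 2"
    by (subst ln_realpow; simp)+
  ultimately have c: "0 < c" unfolding c_def by linarith
  then have a: "0 < a" by (simp add: a_def)
  have "1 - (exp 1 + 1) * exp (- a * real t) \<le> measure_pmf.prob (law t) (?G t)" if t: "1 \<le> t" for t
  proof -
    have "measure_pmf.prob (law t) (- ?G t) \<le>
        measure_pmf.prob (law t) {x. real (hd x) \<le> real t / 342}
        + measure_pmf.prob (law t) {x. 2 / 3 * real t < olives x}"
    proof -
      have "measure_pmf.prob (law t) (- ?G t) \<le> measure_pmf.prob (law t)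
          ({x. real (hd x) \<le> real t / 342} \<union> {x. 2 / 3 * real t < olives x})"
      proof (rule measure_pmf.finite_measure_mono_AE, unfold AE_measure_pmf_iff, intro ballI impI)
        fix x assume x: "x \<in> set_pmf (law t)" "x \<in> - ?G t"
        then have "x \<noteq> []" using law_nonempty t by (cases t) auto
        from hd_le_olives[OF this] x(2)
        show "x \<in> {x. real (hd x) \<le> real t / 342} \<union> {x. 2 / 3 * real t < olives x}" by auto
      qed simp
      also have "\<dots> \<le> measure_pmf.prob (law t) {x. real (hd x) \<le> real t / 342}
        + measure_pmf.prob (law t) {x. 2 / 3 * real t < olives x}"
        by (intro measure_Un_le) auto
      finally show ?thesis .
    qed
    also have "\<dots> \<le> exp (1 - real t / 100000) + exp (- c * real t)"
      unfolding c_def by (intro add_mono prob_first_plate_small t prob_many_olives)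
    also have "\<dots> \<le> exp 1 * exp (- a * real t) + exp (- a * real t)"
    proof (rule add_mono)
      have "a * real t \<le> 1 / 100000 * real t" by (intro mult_right_mono) (auto simp: a_def)
      then show "exp (1 - real t / 100000) \<le> exp 1 * exp (- a * real t)"
        by (simp flip: exp_add)
      have "a * real t \<le> c * real t" by (intro mult_right_mono) (auto simp: a_def)
      then show "exp (- c * real t) \<le> exp (- a * real t)" by simp
    qed
    finally have "measure_pmf.prob (law t) (- ?G t) \<le> (exp 1 + 1) * exp (- a * real t)"
      by (simp add: algebra_simps)
    moreover have "measure_pmf.prob (law t) (- ?G t) = 1 - measure_pmf.prob (law t) (?G t)"
      using measure_pmf.prob_compl[of "?G t" "law t"] by (simp add: Compl_eq_Diff_UNIV)
    ultimately show ?thesis by simp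
  qed
  then show ?thesis
    by (rule exponential_rate_uniform) (use a prob_olives_pos in auto)
qed

section \<open>Concentration\<close>

text \<open>
  As long as the first plate is non-empty, the moves and the evolution of the other plates do not
  depend on its content, which we may therefore take to be one olive.
\<close>

definition others_gain :: "table \<Rightarrow> move \<Rightarrow> real" where
  "others_gain zs m = olives (perform m (Suc 0 # zs)) - olives (Suc 0 # zs)"

definition others_next :: "table \<Rightarrow> move \<Rightarrow> table" where
  "others_next zs m = tl (perform m (Suc 0 # zs))"

lemma moves_first_nonempty: "0 < k \<Longrightarrow> moves (k # zs) = moves (Suc 0 # zs)"
proof -
  assume k: "0 < k"
  have "0 < (k # zs) ! i \<longleftrightarrow> 0 < (Suc 0 # zs) ! i" for i using k by (cases i) auto
  then show ?thesis unfolding moves_def by simp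
qed

lemma olives_perform_first:
  assumes "0 < k" "m \<in> moves (k # zs)"
  shows "olives (perform m (k # zs)) = olives (k # zs) + others_gain zs m"
  using olives_perform[of m "k # zs"] olives_perform[of m "Suc 0 # zs"] assms moves_first_nonempty[of k zs]
  by (simp add: others_gain_def)

lemma tl_perform_first:
  assumes "m \<in> moves (k # zs)"
  shows "tl (perform m (k # zs)) = others_next zs m"
  using assms
  by (cases rule: moves_ConsE)
    (simp_all add: others_next_def perform_Merge_0 perform_Merge_Suc del: perform.simps(2))

lemma Suc_length_others_next:
  "m \<in> moves (Suc 0 # zs) \<Longrightarrow> Suc (length (others_next zs m)) = length (perform m (Suc 0 # zs))"
  using perform_nonempty[of "Suc 0 # zs" m] by (simp add: others_next_def)

section \<open>The later plates as a regenerative chain\<close>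

lemma square_le_two_power: "2 \<le> n \<Longrightarrow> n\<^sup>2 \<le> 2 * 2 ^ (n :: nat)"
proof (induction n rule: dec_induct)
  case (step n)
  have "(Suc n)\<^sup>2 \<le> 2 * n\<^sup>2 + (if n = 2 then 1 else 0)"
  proof (cases "n = 2")
    case False
    then have "3 * n \<le> n * n" using step by (intro mult_right_mono) auto
    then have "2 * n + 1 \<le> n * n" using step(1) by linarith
    then show ?thesis using False by (simp add: power2_eq_square)
  qed simp
  then show ?case using step by (cases "n = 2") auto
qed simp

text \<open>The constant is \<open>2 * 11\<^sup>2 * 2\<close>: the left side is at most twice the
  square, \<open>plate_W n \<le> 11 * n\<close>, and
  \<open>n\<^sup>2 \<le> 2 * 2 ^ n\<close>.\<close>

lemma plate_W_dominated:
  assumes "2 \<le> n"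
  shows "1 + plate_W n + (plate_W n)\<^sup>2 \<le> 484 * plate_v n"
proof -
  have W: "plate_W n = 10 * real n + 2" "2 \<le> plate_W n" using assms by (auto simp: plate_W_def)
  have "1 + plate_W n \<le> (plate_W n)\<^sup>2"
  proof -
    have "2 * plate_W n \<le> plate_W n * plate_W n" using W(2) by (intro mult_right_mono) auto
    then show ?thesis using W(2) unfolding power2_eq_square by linarith
  qed
  moreover have "(plate_W n)\<^sup>2 \<le> (11 * real n)\<^sup>2"
    using assms W by (intro power_mono) auto
  moreover have "real (n\<^sup>2) \<le> real (2 * 2 ^ n)"
    using square_le_two_power[OF assms] by (simp only: of_nat_le_iff)
  ultimately show ?thesis using assms by (simp add: plate_v_def power_mult_distrib)
qed

text \<open>The state is the list of later plates, and regeneration is the return to a single plate.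
  The \<open>Suc\<close> counts the first plate; \<open>1 / 80\<close> is half the contraction rate
  of \<open>plate_v\<close>.\<close>

interpretation others: regenerative_chain
  "\<lambda>zs. moves (Suc 0 # zs)" others_gain others_next "[]"
  "\<lambda>zs. plate_W (Suc (length zs))" "\<lambda>zs. plate_v (Suc (length zs))" 484 "1 / 80"
proof
  fix zs :: table and m
  show "finite (moves (Suc 0 # zs))" by (rule finite_moves)
  show "moves (Suc 0 # zs) \<noteq> {}" by (rule moves_nonempty)
  show "\<bar>others_gain zs m\<bar> \<le> 1" if "m \<in> moves (Suc 0 # zs)"
    unfolding others_gain_def olives_perform[OF that] by (cases m) simp_all
  show "0 \<le> plate_v (Suc (length zs))" by (rule plate_v_nonneg)
  show "0 \<le> plate_W (Suc (length zs))" by (simp add: plate_W_def)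
  assume "zs \<noteq> []"
  then have n: "2 \<le> length (Suc 0 # zs)" by (cases zs) auto
  show "1 + plate_W (Suc (length zs)) + (plate_W (Suc (length zs)))\<^sup>2 \<le> 484 * plate_v (Suc (length zs))"
    using n by (intro plate_W_dominated) simp
  have "mean (moves (Suc 0 # zs)) (\<lambda>m. plate_W (Suc (length (others_next zs m)))) =
      mean (moves (Suc 0 # zs)) (\<lambda>m. plate_W (length (perform m (Suc 0 # zs))))"
    by (intro mean_cong) (simp only: Suc_length_others_next)
  then show "mean (moves (Suc 0 # zs)) (\<lambda>m. plate_W (Suc (length (others_next zs m))))
      \<le> plate_W (Suc (length zs)) - 2"
    using plate_W_drift[OF n] by simp
  have "mean (moves (Suc 0 # zs)) (\<lambda>m. plate_v (Suc (length (others_next zs m)))) =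
      mean (moves (Suc 0 # zs)) (\<lambda>m. plate_v (length (perform m (Suc 0 # zs))))"
    by (intro mean_cong) (simp only: Suc_length_others_next)
  then show "mean (moves (Suc 0 # zs)) (\<lambda>m. plate_v (Suc (length (others_next zs m))))
      \<le> (1 - 2 * (1 / 80)) * plate_v (Suc (length zs))"
    using plate_v_drift[OF n] by simp
qed (simp_all add: plate_W_def plate_v_def)

section \<open>Exponential moments along the actual game\<close>

definition first_nonempty :: "nat \<Rightarrow> nat \<Rightarrow> table list set" where
  "first_nonempty s t = {h. \<forall>r\<in>{s..<t}. 0 < hd (h ! r)}"

lemma expectation_game_mono:
  assumes "\<And>h. h \<in> set_pmf (game t) \<Longrightarrow> f h \<le> (g h :: real)"
  shows "measure_pmf.expectation (game t) f \<le> measure_pmf.expectation (game t) g"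
  by (rule integral_mono_AE) (auto simp: AE_measure_pmf_iff assms)

lemma game_table_nonempty: "h \<in> set_pmf (game t) \<Longrightarrow> 1 \<le> t \<Longrightarrow> last h \<noteq> []"
  using law_nonempty[of "last h" "t - 1"] by (cases t) (auto simp: law_def)

text \<open>While the first plate is non-empty, the actual game moves like the chain, so attaching
  the moment generating function of the remaining moves gives an exact martingale step. If the first
  plate is empty, the left side drops to 0, hence only an inequality.\<close>

lemma expectation_mgf_step:
  assumes "1 \<le> s" "s \<le> t"
  shows "measure_pmf.expectation (game (Suc t)) (\<lambda>h. indicator (first_nonempty s (Suc t)) h *
      (exp (l * olives (h ! Suc t)) * others.mgf l n (tl (h ! Suc t)))) \<le>
    measure_pmf.expectation (game t) (\<lambda>h. indicator (first_nonempty s t) h *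
      (exp (l * olives (h ! t)) * others.mgf l (Suc n) (tl (h ! t))))"
  unfolding expectation_game_Suc
proof (rule expectation_game_mono)
  fix h assume h: "h \<in> set_pmf (game t)"
  obtain k zs where x: "last h = k # zs"
    using game_table_nonempty[OF h] assms by (cases "last h") auto
  have len: "length h = Suc t" by (rule length_game[OF h])
  have ht: "h ! t = k # zs" using game_last[OF h] x by simp
  \<comment> \<open>The event concerns only tables from which a move is made, so appending a table
    adds just the condition at time \<open>t\<close>.\<close>
  have ind: "h @ [y] \<in> first_nonempty s (Suc t) \<longleftrightarrow> h \<in> first_nonempty s t \<and> 0 < k" for y
  proof -
    have set: "{s..<Suc t} = insert t {s..<t}" using assms by auto
    have old: "(h @ [y]) ! r = h ! r" if "r \<le> t" for r using that len by (simp add: nth_append)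
    have "(\<forall>r\<in>{s..<Suc t}. 0 < hd ((h @ [y]) ! r)) \<longleftrightarrow>
        0 < hd ((h @ [y]) ! t) \<and> (\<forall>r\<in>{s..<t}. 0 < hd ((h @ [y]) ! r))"
      unfolding set by blast
    also have "0 < hd ((h @ [y]) ! t) \<longleftrightarrow> 0 < k"
      by (simp only: old[OF order_refl] ht list.sel)
    also have "(\<forall>r\<in>{s..<t}. 0 < hd ((h @ [y]) ! r)) \<longleftrightarrow> (\<forall>r\<in>{s..<t}. 0 < hd (h ! r))"
      by (intro ball_cong refl) (simp add: old)
    finally have eq: "(\<forall>r\<in>{s..<Suc t}. 0 < hd ((h @ [y]) ! r)) \<longleftrightarrow>
        0 < k \<and> (\<forall>r\<in>{s..<t}. 0 < hd (h ! r))" .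
    show ?thesis by (simp only: first_nonempty_def mem_Collect_eq eq conj_commute)
  qed
  have new: "(h @ [y]) ! Suc t = y" for y using len by (simp add: nth_append)
  let ?e = "exp (l * olives (k # zs))"
  show "mean (moves (last h)) (\<lambda>m. indicator (first_nonempty s (Suc t)) (h @ [perform m (last h)]) *
      (exp (l * olives ((h @ [perform m (last h)]) ! Suc t)) *
        others.mgf l n (tl ((h @ [perform m (last h)]) ! Suc t)))) \<le>
    indicator (first_nonempty s t) h * (exp (l * olives (h ! t)) * others.mgf l (Suc n) (tl (h ! t)))"
  proof (cases "h \<in> first_nonempty s t \<and> 0 < k")
    case False
    then have "indicator (first_nonempty s (Suc t)) (h @ [y]) = (0 :: real)" for y
      by (simp add: ind)
    then show ?thesis using others.mgf_nonneg[of l "Suc n" "tl (h ! t)"]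
      by (simp del: others.mgf.simps)
  next
    case True
    have "mean (moves (k # zs)) (\<lambda>m. exp (l * olives (perform m (k # zs))) *
        others.mgf l n (tl (perform m (k # zs)))) =
      mean (moves (k # zs)) (\<lambda>m. ?e * (exp (l * others_gain zs m) * others.mgf l n (others_next zs m)))"
      using True by (intro mean_cong)
        (simp add: olives_perform_first tl_perform_first distrib_left exp_add)
    also have "\<dots> = ?e * others.mgf l (Suc n) zs"
      using True moves_first_nonempty[of k zs] by (simp add: mean_cmult)
    finally show ?thesis using True ht unfolding x new by (simp add: ind)
  qed
qed

lemma expectation_mgf_le:
  assumes "1 \<le> s"
  shows "measure_pmf.expectation (game (s + k)) (\<lambda>h. indicator (first_nonempty s (s + k)) h *
      (exp (l * olives (h ! (s + k))) * others.mgf l n (tl (h ! (s + k))))) \<le>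
    measure_pmf.expectation (law s) (\<lambda>x. exp (l * olives x) * others.mgf l (n + k) (tl x))"
proof (induction k arbitrary: n)
  case 0
  show ?case using expectation_game_law[OF order_refl, where f = "\<lambda>x. exp (l * olives x) * others.mgf l n (tl x)"]
    by (simp add: first_nonempty_def)
next
  case (Suc k)
  show ?case using order.trans[OF expectation_mgf_step[OF assms le_add1, of k l n] Suc[of "Suc n"]]
    by simp
qed

lemma olives_nonneg: "0 \<le> olives x"
  by (simp add: olives_def)

lemma olives_le: "x \<in> set_pmf (law t) \<Longrightarrow> olives x \<le> real t"
proof (induction t arbitrary: x)
  case 0
  then show ?case by (simp add: law_0 olives_def)
next
  case (Suc t)
  then obtain y m where y: "y \<in> set_pmf (law t)" "m \<in> moves y" "x = perform m y"
    unfolding set_law_Suc by blast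
  then show ?case using Suc.IH[OF y(1)] olives_perform[OF y(2)] by (cases m) simp_all
qed

text \<open>A union bound over the times from \<open>s\<close> on; the tails of the first plate form
  a geometric series, so the result does not grow with \<open>t\<close>.\<close>

lemma prob_first_empty_le:
  assumes "1 \<le> s"
  shows "measure_pmf.prob (game t) (- first_nonempty s t)
    \<le> exp 1 / (1 - exp (- 1 / 100000)) * exp (- real s / 100000)"
proof (cases "s \<le> t")
  case False
  then show ?thesis by (simp add: first_nonempty_def)
next
  case True
  define a where "a = exp (- 1 / 100000 :: real)"
  have a: "0 < a" "a < 1" by (auto simp: a_def)
  have pow: "exp (- real n / 100000) = a ^ n" for n by (simp add: a_def flip: exp_of_nat_mult)
  have "- first_nonempty s t \<subseteq> (\<Union>r\<in>{s..<t}. {h. hd (h ! r) = 0})"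
    by (auto simp: first_nonempty_def)
  then have "measure_pmf.prob (game t) (- first_nonempty s t) \<le>
      measure_pmf.prob (game t) (\<Union>r\<in>{s..<t}. {h. hd (h ! r) = 0})"
    by (intro measure_pmf.finite_measure_mono) auto
  also have "\<dots> \<le> (\<Sum>r\<in>{s..<t}. measure_pmf.prob (game t) {h. hd (h ! r) = 0})"
    by (intro measure_pmf.finite_measure_subadditive_finite) auto
  also have "\<dots> \<le> (\<Sum>r\<in>{s..<t}. exp 1 * a ^ r)"
  proof (rule sum_mono)
    fix r assume r: "r \<in> {s..<t}"
    have "measure_pmf.prob (game t) {h. hd (h ! r) = 0} = measure_pmf.prob (law r) {x. hd x = 0}"
      using r by (intro prob_game_law) simp
    also have "\<dots> \<le> measure_pmf.prob (law r) {x. real (hd x) \<le> real r / 342}"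
      by (intro measure_pmf.finite_measure_mono) auto
    also have "\<dots> \<le> exp (1 - real r / 100000)"
      using r assms by (intro prob_first_plate_small) simp
    also have "\<dots> = exp 1 * a ^ r" unfolding pow[symmetric] by (simp flip: exp_add)
    finally show "measure_pmf.prob (game t) {h. hd (h ! r) = 0} \<le> exp 1 * a ^ r" .
  qed
  also have "\<dots> = exp 1 * ((a ^ s - a ^ t) / (1 - a))"
  proof -
    have "(\<Sum>r\<in>{s..<t}. a ^ r) * (1 - a) = a ^ s - a ^ t"
      using True
    proof (induction t rule: dec_induct)
      case (step n)
      then have "(\<Sum>r\<in>{s..<Suc n}. a ^ r) * (1 - a) = (a ^ s - a ^ n) + a ^ n * (1 - a)"
        by (simp add: distrib_right)
      then show ?case by (simp add: right_diff_distrib)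
    qed simp
    then show ?thesis using a by (simp add: sum_distrib_left[symmetric] eq_divide_eq)
  qed
  also have "\<dots> \<le> exp 1 * (a ^ s / (1 - a))"
    using a by (intro mult_left_mono divide_right_mono) auto
  finally show ?thesis unfolding pow by (simp add: a_def)
qed

section \<open>Gaussian tails around the centre\<close>

definition centre :: "nat \<Rightarrow> real" where
  "centre t = others.gain t []"

lemma abs_centre_le: "\<bar>centre t\<bar> \<le> real t"
  using others.gain_diff_le[of 0 t "[]"] by (simp add: centre_def)

text \<open>The chain is started from the random table at time \<open>s\<close>. At that time the
  olives cost at most \<open>exp (\<bar>l\<bar> * s)\<close>, and the corrector is bounded through
  \<open>spill\<close>, whose mean is uniformly bounded.\<close>

lemma expectation_exp_le:
  obtains c G l0 where "0 < c" "0 < G" "0 < l0" "l0 \<le> 1"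
    "\<And>l s n. \<bar>l\<bar> \<le> l0 \<Longrightarrow> 1 \<le> s \<Longrightarrow>
      measure_pmf.expectation (game (s + n))
        (\<lambda>h. indicator (first_nonempty s (s + n)) h * exp (l * (olives (h ! (s + n)) - centre n)))
      \<le> G * exp (\<bar>l\<bar> * real s + c * l\<^sup>2 * real n)"
proof -
  obtain c D l1 where c: "0 < c" "0 < D" "0 < l1"
    and mgf: "\<And>l n x. \<bar>l\<bar> \<le> l1 \<Longrightarrow> others.mgf l n x \<le> exp (l * others.gain n [] + c * l\<^sup>2 * real n) *
      (1 + l * (others.gain n x - others.gain n []) + l\<^sup>2 * (D * plate_v (Suc (length x))))"
    using others.mgf_le by blast
  define G where "G = 1 + (484 + D) * 810"
  define l0 where "l0 = min 1 l1"
  have "measure_pmf.expectation (game (s + n))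
        (\<lambda>h. indicator (first_nonempty s (s + n)) h * exp (l * (olives (h ! (s + n)) - centre n)))
      \<le> G * exp (\<bar>l\<bar> * real s + c * l\<^sup>2 * real n)" if l: "\<bar>l\<bar> \<le> l0" and s: "1 \<le> s" for l s n
  proof -
    have l1: "\<bar>l\<bar> \<le> 1" "\<bar>l\<bar> \<le> l1" using l by (auto simp: l0_def)
    define E where "E = exp (l * centre n)"
    have E: "0 < E" by (simp add: E_def)
    let ?Q = "exp (\<bar>l\<bar> * real s) * E * exp (c * l\<^sup>2 * real n)"
    have "measure_pmf.expectation (game (s + n))
        (\<lambda>h. indicator (first_nonempty s (s + n)) h * exp (l * olives (h ! (s + n)))) \<le>
      measure_pmf.expectation (law s) (\<lambda>x. exp (l * olives x) * others.mgf l n (tl x))"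
      using expectation_mgf_le[OF s, of n l 0] by simp
    also have "\<dots> \<le> measure_pmf.expectation (law s) (\<lambda>x. ?Q * (1 + (484 + D) * spill x))"
    proof (rule expectation_law_mono)
      fix x assume x: "x \<in> set_pmf (law s)"
      have "x \<noteq> []" using law_nonempty x s by (cases s) auto
      then have len: "Suc (length (tl x)) = length x" by simp
      let ?v = "plate_v (length x)" and ?q = "others.gain n (tl x) - others.gain n []"
      have v: "0 \<le> ?v" by (rule plate_v_nonneg)
      have "l * ?q \<le> \<bar>l\<bar> * \<bar>?q\<bar>" by (metis abs_ge_self abs_mult)
      also have "\<dots> \<le> 1 * (484 * ?v)"
        using l1 others.gain_root_le[of n "tl x"] others.W_le[of "tl x"] unfolding len
        by (intro mult_mono) auto
      finally have q: "l * ?q \<le> 484 * ?v" by simp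
      have "l\<^sup>2 \<le> 1" using l1 by (simp add: abs_square_le_1)
      then have "l\<^sup>2 * (D * ?v) \<le> 1 * (D * ?v)" using c v by (intro mult_right_mono) auto
      with q have "1 + l * ?q + l\<^sup>2 * (D * ?v) \<le> 1 + (484 + D) * ?v" by (simp add: algebra_simps)
      also have "?v \<le> spill x"
      proof -
        have "1 * (?v + 1) \<le> (91 / 90) ^ others xs * (?v + 1)" for xs
          using v by (intro mult_right_mono one_le_power) auto
        from this[of x] show ?thesis by (simp add: spill_def)
      qed
      finally have A: "1 + l * ?q + l\<^sup>2 * (D * ?v) \<le> 1 + (484 + D) * spill x"
        using c by simp
      have "others.mgf l n (tl x) \<le> E * exp (c * l\<^sup>2 * real n) * (1 + l * ?q + l\<^sup>2 * (D * ?v))"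
        using mgf[OF l1(2), of n "tl x"] unfolding len by (simp add: E_def centre_def exp_add)
      also have "\<dots> \<le> E * exp (c * l\<^sup>2 * real n) * (1 + (484 + D) * spill x)"
        using A E by (intro mult_left_mono) auto
      finally have B: "others.mgf l n (tl x) \<le> E * exp (c * l\<^sup>2 * real n) * (1 + (484 + D) * spill x)" .
      have "l * olives x \<le> \<bar>l\<bar> * real s"
        using olives_le[OF x] olives_nonneg[of x] by (intro mult_mono) auto
      then have "exp (l * olives x) * others.mgf l n (tl x) \<le>
          exp (\<bar>l\<bar> * real s) * (E * exp (c * l\<^sup>2 * real n) * (1 + (484 + D) * spill x))"
        using B others.mgf_nonneg by (intro mult_mono) auto
      then show "exp (l * olives x) * others.mgf l n (tl x) \<le> ?Q * (1 + (484 + D) * spill x)"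
        by (simp add: mult.assoc)
    qed
    also have "\<dots> = ?Q * (1 + (484 + D) * measure_pmf.expectation (law s) spill)"
      by simp
    also have "\<dots> \<le> ?Q * G"
      unfolding G_def using expectation_spill_le[of s] c E by (intro mult_left_mono add_left_mono) auto
    finally have F: "measure_pmf.expectation (game (s + n))
        (\<lambda>h. indicator (first_nonempty s (s + n)) h * exp (l * olives (h ! (s + n)))) \<le> ?Q * G" .
    have "(\<lambda>h. indicator (first_nonempty s (s + n)) h * exp (l * (olives (h ! (s + n)) - centre n))) =
        (\<lambda>h. indicator (first_nonempty s (s + n)) h * exp (l * olives (h ! (s + n))) / E)"
      by (simp add: E_def right_diff_distrib exp_diff)
    then have "measure_pmf.expectation (game (s + n))
        (\<lambda>h. indicator (first_nonempty s (s + n)) h * exp (l * (olives (h ! (s + n)) - centre n))) =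
      measure_pmf.expectation (game (s + n))
        (\<lambda>h. indicator (first_nonempty s (s + n)) h * exp (l * olives (h ! (s + n)))) / E"
      by simp
    also have "\<dots> \<le> ?Q * G / E" using F E by (intro divide_right_mono) auto
    also have "\<dots> = G * exp (\<bar>l\<bar> * real s + c * l\<^sup>2 * real n)"
      using E by (simp add: exp_add)
    finally show ?thesis .
  qed
  moreover have "0 < G" "0 < l0" "l0 \<le> 1" using c by (auto simp: G_def l0_def)
  ultimately show thesis using that c(1) by blast
qed

text \<open>Chernoff's bound, with \<open>\<sigma>\<close> selecting the tail. Passing from
  \<open>centre n\<close> to \<open>centre (s + n)\<close> gives up at most \<open>s\<close> of the
  deviation.\<close>

lemma prob_one_sided_le:
  fixes \<sigma> :: real
  assumes bound: "measure_pmf.expectation (game (s + n))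
        (\<lambda>h. indicator (first_nonempty s (s + n)) h * exp ((\<sigma> * u) * (olives (h ! (s + n)) - centre n)))
      \<le> R" and u: "0 \<le> u" and \<sigma>: "\<bar>\<sigma>\<bar> = 1"
  shows "measure_pmf.prob (game (s + n))
      ({h. a \<le> \<sigma> * (olives (h ! (s + n)) - centre (s + n))} \<inter> first_nonempty s (s + n))
    \<le> R * exp (- (u * (a - real s)))"
proof -
  let ?S = "{h. a \<le> \<sigma> * (olives (h ! (s + n)) - centre (s + n))} \<inter> first_nonempty s (s + n)"
  have diff: "\<bar>centre (s + n) - centre n\<bar> \<le> real s"
    using others.gain_diff_le[of n s "[]"] by (simp add: centre_def add.commute)
  have "measure_pmf.prob (game (s + n)) ?S = measure_pmf.expectation (game (s + n)) (indicator ?S)"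
    by simp
  also have "\<dots> \<le> measure_pmf.expectation (game (s + n)) (\<lambda>h. exp (- (u * (a - real s))) *
     (indicator (first_nonempty s (s + n)) h * exp ((\<sigma> * u) * (olives (h ! (s + n)) - centre n))))"
  proof (rule expectation_game_mono)
    fix h
    let ?X = "olives (h ! (s + n))"
    show "indicator ?S h \<le> exp (- (u * (a - real s))) *
      (indicator (first_nonempty s (s + n)) h * exp ((\<sigma> * u) * (?X - centre n)))"
    proof (cases "h \<in> ?S")
      case True
      have "\<sigma> * (centre (s + n) - centre n) \<ge> - real s"
      proof -
        have "\<bar>\<sigma> * (centre (s + n) - centre n)\<bar> \<le> real s" using diff \<sigma> by (simp add: abs_mult)
        then show ?thesis by linarith
      qed
      moreover have "\<sigma> * (?X - centre n) = \<sigma> * (?X - centre (s + n)) + \<sigma> * (centre (s + n) - centre n)"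
        by (simp add: algebra_simps)
      ultimately have "a - real s \<le> \<sigma> * (?X - centre n)" using True by simp
      then have "u * (a - real s) \<le> u * (\<sigma> * (?X - centre n))" using u by (rule mult_left_mono)
      then have "1 \<le> exp (- (u * (a - real s)) + (\<sigma> * u) * (?X - centre n))" by (simp add: mult_ac)
      also have "\<dots> = exp (- (u * (a - real s))) * exp ((\<sigma> * u) * (?X - centre n))" by (rule exp_add)
      finally show ?thesis using True by simp
    qed simp
  qed
  also have "\<dots> = exp (- (u * (a - real s))) * measure_pmf.expectation (game (s + n)) (\<lambda>h.
     indicator (first_nonempty s (s + n)) h * exp ((\<sigma> * u) * (olives (h ! (s + n)) - centre n)))"
    by simp
  also have "\<dots> \<le> exp (- (u * (a - real s))) * R"
    using bound by (intro mult_left_mono) auto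
  finally show ?thesis by (simp add: mult.commute)
qed

lemma prob_deviation_unit:
  obtains A G where "0 < A" "1 \<le> G"
    "\<And>\<delta> t. 0 \<le> \<delta> \<Longrightarrow> \<delta> \<le> 1 \<Longrightarrow> 2 \<le> t \<Longrightarrow>
      measure_pmf.prob (law t) {x. \<delta> * real t \<le> \<bar>olives x - centre t\<bar>} \<le> G * exp (- A * \<delta>\<^sup>2 * real t)"
proof -
  obtain c G0 l0 where c: "0 < c" "0 < G0" "0 < l0" "l0 \<le> 1" and mgf:
    "\<And>l s n. \<bar>l\<bar> \<le> l0 \<Longrightarrow> 1 \<le> s \<Longrightarrow> measure_pmf.expectation (game (s + n))
        (\<lambda>h. indicator (first_nonempty s (s + n)) h * exp (l * (olives (h ! (s + n)) - centre n)))
      \<le> G0 * exp (\<bar>l\<bar> * real s + c * l\<^sup>2 * real n)"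
    using expectation_exp_le by blast
  \<comment> \<open>The tilt will be \<open>\<kappa> * \<delta>\<close>: it stays below
    \<open>l0\<close>, and \<open>c * \<kappa> \<le> 1 / 4\<close> keeps the quadratic term at a
    quarter of the gain. In \<open>A\<close>, \<open>1 / 800000\<close> comes from the first plate
    being empty after a time of at least \<open>\<delta> * t / 8\<close>.\<close>
  define \<kappa> where "\<kappa> = min l0 (1 / (4 * c))"
  define A where "A = min (\<kappa> / 2) (1 / 800000)"
  define H :: real where "H = exp 1 / (1 - exp (- 1 / 100000))"
  define G where "G = 2 * G0 * exp 2 + H + 1"
  have \<kappa>: "0 < \<kappa>" "\<kappa> \<le> l0" "c * \<kappa> \<le> 1 / 4"
  proof -
    show "0 < \<kappa>" "\<kappa> \<le> l0" using c by (auto simp: \<kappa>_def)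
    have "c * \<kappa> \<le> c * (1 / (4 * c))" using c by (intro mult_left_mono) (auto simp: \<kappa>_def)
    then show "c * \<kappa> \<le> 1 / 4" using c by simp
  qed
  have H: "0 < H" by (simp add: H_def)
  have "measure_pmf.prob (law t) {x. \<delta> * real t \<le> \<bar>olives x - centre t\<bar>} \<le> G * exp (- A * \<delta>\<^sup>2 * real t)"
    if \<delta>: "0 \<le> \<delta>" "\<delta> \<le> 1" and t: "2 \<le> t" for \<delta> t
  proof -
    \<comment> \<open>\<open>s\<close> is charged twice, for the olives at time \<open>s\<close> and
      for the shift of the centre; an eighth of the deviation each leaves enough. \<open>Suc\<close>
      keeps \<open>s \<ge> 1\<close> even at \<open>\<delta> = 0\<close>, at the price of the
      constant \<open>exp 2\<close>.\<close>
    define s where "s = Suc (nat \<lfloor>\<delta> * real t / 8\<rfloor>)"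
    have nn: "0 \<le> \<delta> * real t / 8" using \<delta> by simp
    then have s: "1 \<le> s" "real s \<le> \<delta> * real t / 8 + 1" "\<delta> * real t / 8 \<le> real s"
      unfolding s_def by linarith+
    have "\<delta> * real t \<le> 1 * real t" using \<delta> by (intro mult_right_mono) auto
    then have "real s < real t + 1" using s(2) nn t by linarith
    then have "s \<le> t" by linarith
    then obtain n where n: "t = s + n" using le_Suc_ex by blast
    define u where "u = \<kappa> * \<delta>"
    have u: "0 \<le> u" "u \<le> l0" using \<kappa> \<delta> mult_mono[of \<kappa> l0 \<delta> 1] c by (auto simp: u_def)
    let ?S = "\<lambda>\<sigma>. {h. \<delta> * real t \<le> \<sigma> * (olives (h ! t) - centre t)} \<inter> first_nonempty s t"
    have side: "measure_pmf.prob (game t) (?S \<sigma>) \<le> G0 * exp 2 * exp (- A * \<delta>\<^sup>2 * real t)"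
      if \<sigma>: "\<bar>\<sigma>\<bar> = 1" for \<sigma>
    proof -
      have \<sigma>u: "\<bar>\<sigma> * u\<bar> = u" "(\<sigma> * u)\<^sup>2 = u\<^sup>2"
        using \<sigma> u by (simp_all add: abs_mult power_mult_distrib) (metis one_power2 power2_abs)
      have "measure_pmf.prob (game t) (?S \<sigma>) \<le>
          (G0 * exp (u * real s + c * u\<^sup>2 * real n)) * exp (- (u * (\<delta> * real t - real s)))"
        unfolding n using mgf[of "\<sigma> * u" s n] u s \<sigma> \<sigma>u
        by (intro prob_one_sided_le) auto
      also have "\<dots> = G0 * exp (2 * (u * real s) + c * u\<^sup>2 * real n - u * (\<delta> * real t))"
        by (simp add: mult.assoc right_diff_distrib flip: exp_add)
      also have "\<dots> \<le> G0 * exp (2 + - A * \<delta>\<^sup>2 * real t)"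
      proof -
        define X where "X = \<kappa> * \<delta>\<^sup>2 * real t"
        have X: "u * (\<delta> * real t) = X" "c * u\<^sup>2 * real t = (c * \<kappa>) * X"
          by (simp_all add: X_def u_def power2_eq_square mult_ac)
        have "u * real s \<le> u * (\<delta> * real t / 8 + 1)" using s u by (intro mult_left_mono) auto
        also have "\<dots> = u * (\<delta> * real t) / 8 + u" by (simp add: distrib_left)
        finally have 1: "u * real s \<le> X / 8 + 1" using u c X by simp
        have "0 \<le> X" using \<kappa> by (simp add: X_def)
        then have "(c * \<kappa>) * X \<le> 1 / 4 * X" using \<kappa> by (intro mult_right_mono) auto
        moreover have "c * u\<^sup>2 * real n \<le> c * u\<^sup>2 * real t"
          using c n by (intro mult_left_mono) auto
        ultimately have 2: "c * u\<^sup>2 * real n \<le> X / 4" using X by simp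
        have "A * (\<delta>\<^sup>2 * real t) \<le> \<kappa> / 2 * (\<delta>\<^sup>2 * real t)"
          by (intro mult_right_mono) (auto simp: A_def)
        then have 3: "- A * \<delta>\<^sup>2 * real t \<ge> - (X / 2)" by (simp add: X_def mult.assoc)
        have "2 * (u * real s) + c * u\<^sup>2 * real n - u * (\<delta> * real t) \<le> 2 + - A * \<delta>\<^sup>2 * real t"
          unfolding X(1) using 1 2 3 by linarith
        then show ?thesis using c by simp
      qed
      also have "\<dots> = G0 * exp 2 * exp (- A * \<delta>\<^sup>2 * real t)"
        by (simp only: exp_add mult.assoc)
      finally show ?thesis .
    qed
    have "measure_pmf.prob (law t) {x. \<delta> * real t \<le> \<bar>olives x - centre t\<bar>} =
        measure_pmf.prob (game t) {h. \<delta> * real t \<le> \<bar>olives (h ! t) - centre t\<bar>}"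
      by (rule prob_game_law[symmetric]) simp
    also have "\<dots> \<le> measure_pmf.prob (game t) ((?S 1 \<union> ?S (-1)) \<union> (- first_nonempty s t))"
      by (intro measure_pmf.finite_measure_mono) (auto simp: abs_if split: if_splits)
    also have "\<dots> \<le> measure_pmf.prob (game t) (?S 1 \<union> ?S (-1)) + measure_pmf.prob (game t) (- first_nonempty s t)"
      by (intro measure_Un_le) auto
    also have "measure_pmf.prob (game t) (?S 1 \<union> ?S (-1)) \<le>
        measure_pmf.prob (game t) (?S 1) + measure_pmf.prob (game t) (?S (-1))"
      by (intro measure_Un_le) auto
    also have "measure_pmf.prob (game t) (?S 1) \<le> G0 * exp 2 * exp (- A * \<delta>\<^sup>2 * real t)"
      by (rule side) simp
    also have "measure_pmf.prob (game t) (?S (-1)) \<le> G0 * exp 2 * exp (- A * \<delta>\<^sup>2 * real t)"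
      by (rule side) simp
    also have "measure_pmf.prob (game t) (- first_nonempty s t) \<le> H * exp (- real s / 100000)"
      unfolding H_def by (rule prob_first_empty_le[OF s(1)])
    also have "H * exp (- real s / 100000) \<le> H * exp (- A * \<delta>\<^sup>2 * real t)"
    proof -
      have "A * (\<delta>\<^sup>2 * real t) \<le> 1 / 800000 * (\<delta>\<^sup>2 * real t)"
        by (intro mult_right_mono) (auto simp: A_def)
      also have "\<delta>\<^sup>2 * real t \<le> \<delta> * real t"
        using \<delta> mult_left_mono[of \<delta> 1 \<delta>] by (intro mult_right_mono) (auto simp: power2_eq_square)
      finally have "A * (\<delta>\<^sup>2 * real t) \<le> real s / 100000" using s(3) by simp
      then show ?thesis using H by (simp add: mult.assoc)
    qed
    finally have "measure_pmf.prob (law t) {x. \<delta> * real t \<le> \<bar>olives x - centre t\<bar>} \<le>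
        (G - 1) * exp (- A * \<delta>\<^sup>2 * real t)"
      by (simp add: G_def algebra_simps)
    also have "\<dots> \<le> G * exp (- A * \<delta>\<^sup>2 * real t)" by (intro mult_right_mono) auto
    finally show ?thesis .
  qed
  moreover have "0 < A" "1 \<le> G" using \<kappa> c H by (auto simp: A_def G_def)
  ultimately show thesis using that by blast
qed

text \<open>Up to \<open>\<delta> = 2\<close> halving \<open>\<delta>\<close> reduces to the unit
  range at the cost of a factor 4 in the rate; beyond that the event is impossible, as the deviation
  never exceeds \<open>2 * t\<close>.\<close>

lemma prob_deviation:
  obtains A G where "0 < A" "1 \<le> G"
    "\<And>\<delta> t. 0 \<le> \<delta> \<Longrightarrow> 2 \<le> t \<Longrightarrow>
      measure_pmf.prob (law t) {x. \<delta> * real t \<le> \<bar>olives x - centre t\<bar>} \<le> G * exp (- A * \<delta>\<^sup>2 * real t)"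
proof -
  obtain A G where A: "0 < A" "1 \<le> G" and unit: "\<And>\<delta> t. 0 \<le> \<delta> \<Longrightarrow> \<delta> \<le> 1 \<Longrightarrow> 2 \<le> t \<Longrightarrow>
      measure_pmf.prob (law t) {x. \<delta> * real t \<le> \<bar>olives x - centre t\<bar>} \<le> G * exp (- A * \<delta>\<^sup>2 * real t)"
    using prob_deviation_unit by blast
  have "measure_pmf.prob (law t) {x. \<delta> * real t \<le> \<bar>olives x - centre t\<bar>} \<le> G * exp (- (A / 4) * \<delta>\<^sup>2 * real t)"
    if \<delta>: "0 \<le> \<delta>" and t: "2 \<le> t" for \<delta> t
  proof (cases "\<delta> \<le> 2")
    case True
    have "\<delta> / 2 * real t \<le> \<delta> * real t" using \<delta> by (intro mult_right_mono) auto
    then have "measure_pmf.prob (law t) {x. \<delta> * real t \<le> \<bar>olives x - centre t\<bar>} \<le>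
        measure_pmf.prob (law t) {x. \<delta> / 2 * real t \<le> \<bar>olives x - centre t\<bar>}"
      by (intro measure_pmf.finite_measure_mono) auto
    also have "\<dots> \<le> G * exp (- A * (\<delta> / 2)\<^sup>2 * real t)"
      using True \<delta> t by (intro unit) auto
    finally show ?thesis by (simp add: power_divide)
  next
    case False
    have "\<bar>olives x - centre t\<bar> < \<delta> * real t" if "x \<in> set_pmf (law t)" for x
    proof -
      have "\<bar>olives x - centre t\<bar> \<le> 2 * real t"
        using olives_le[OF that] olives_nonneg[of x] abs_centre_le[of t] by linarith
      also have "\<dots> < \<delta> * real t" using False t by (intro mult_strict_right_mono) auto
      finally show ?thesis .
    qed
    then have "measure_pmf.prob (law t) {x. \<delta> * real t \<le> \<bar>olives x - centre t\<bar>} = 0"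
      by (subst measure_pmf_zero_iff) (auto simp: not_le disjoint_iff)
    then show ?thesis using A by simp
  qed
  with A that[of "A / 4" G] show thesis by simp
qed

section \<open>From the centre to the mean\<close>

lemma expectation_deviation_le:
  assumes t: "2 \<le> t" and A: "0 < A" and G: "1 \<le> G"
    and tail: "\<And>\<delta>. 0 \<le> \<delta> \<Longrightarrow>
      measure_pmf.prob (law t) {x. \<delta> * real t \<le> \<bar>olives x - centre t\<bar>} \<le> G * exp (- A * \<delta>\<^sup>2 * real t)"
  shows "\<bar>measure_pmf.expectation (law t) olives - centre t\<bar> \<le> G / (1 - exp (- A)) * sqrt (real t)"
proof -
  let ?R = "\<lambda>x. \<bar>olives x - centre t\<bar>" and ?r = "sqrt (real t)"
  define a where "a = exp (- A)"
  have a: "0 < a" "a < 1" using A by (auto simp: a_def)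
  have r: "1 \<le> ?r" using t by simp
  have "\<bar>measure_pmf.expectation (law t) olives - centre t\<bar> =
      \<bar>measure_pmf.expectation (law t) (\<lambda>x. olives x - centre t)\<bar>"
    by simp
  also have "\<dots> \<le> measure_pmf.expectation (law t) ?R"
    by (rule integral_abs_bound)
  \<comment> \<open>A discrete layer-cake bound in units of \<open>sqrt t\<close>; at most
    \<open>2 * t\<close> is reached, so the sum can be finite.\<close>
  also have "\<dots> \<le> measure_pmf.expectation (law t)
      (\<lambda>x. ?r * (\<Sum>k\<le>2 * t. indicator {x. real k * ?r \<le> ?R x} x))"
  proof (rule expectation_law_mono)
    fix x assume x: "x \<in> set_pmf (law t)"
    define j where "j = nat \<lfloor>?R x / ?r\<rfloor>"
    have "0 \<le> ?R x / ?r" using r by simp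
    then have j: "real j \<le> ?R x / ?r" "?R x / ?r < real j + 1" unfolding j_def by linarith+
    have "?R x / ?r \<le> ?R x / 1" using r by (intro divide_left_mono) auto
    also have "\<dots> \<le> 2 * real t"
      unfolding div_by_1 using olives_le[OF x] olives_nonneg[of x] abs_centre_le[of t] by linarith
    finally have "real j \<le> real (2 * t)" using j by simp
    then have j2: "j \<le> 2 * t" by (simp only: of_nat_le_iff)
    have "real j + 1 = (\<Sum>k\<le>j. 1)" by simp
    also have "\<dots> \<le> (\<Sum>k\<le>j. indicator {x. real k * ?r \<le> ?R x} x)"
    proof (rule sum_mono)
      fix k assume "k \<in> {..j}"
      then have "real k \<le> ?R x / ?r" using j(1) by simp
      then show "(1 :: real) \<le> indicator {x. real k * ?r \<le> ?R x} x" using r by (simp add: le_divide_eq)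
    qed
    also have "\<dots> \<le> (\<Sum>k\<le>2 * t. indicator {x. real k * ?r \<le> ?R x} x)"
      using j2 by (intro sum_mono2) auto
    finally have "?R x / ?r \<le> (\<Sum>k\<le>2 * t. indicator {x. real k * ?r \<le> ?R x} x)" using j by linarith
    then show "?R x \<le> ?r * (\<Sum>k\<le>2 * t. indicator {x. real k * ?r \<le> ?R x} x)"
      using r by (simp add: divide_le_eq mult.commute)
  qed
  also have "\<dots> = ?r * (\<Sum>k\<le>2 * t. measure_pmf.prob (law t) {x. real k * ?r \<le> ?R x})"
    by simp
  also have "\<dots> \<le> ?r * (\<Sum>k\<le>2 * t. G * a ^ k)"
  proof (intro mult_left_mono sum_mono)
    fix k
    \<comment> \<open>With \<open>\<delta> = k / sqrt t\<close> the exponent becomes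
      \<open>A * k\<^sup>2\<close>, independent of \<open>t\<close>.\<close>
    have e: "real k / ?r * real t = real k * ?r" "(real k / ?r)\<^sup>2 * real t = (real k)\<^sup>2"
      using t by (simp_all add: field_simps)
    have "measure_pmf.prob (law t) {x. real k * ?r \<le> ?R x} \<le> G * exp (- A * (real k)\<^sup>2)"
      using tail[of "real k / ?r"] r e by (simp add: mult.assoc)
    also have "\<dots> \<le> G * exp (- A * real k)"
    proof -
      have "real k \<le> (real k)\<^sup>2" by (cases k) (auto simp: power2_eq_square)
      then show ?thesis using A G by simp
    qed
    also have "exp (- A * real k) = a ^ k" unfolding a_def by (rule exp_of_nat2_mult)
    finally show "measure_pmf.prob (law t) {x. real k * ?r \<le> ?R x} \<le> G * a ^ k" .
  qed simp
  also have "\<dots> \<le> ?r * (G * (1 / (1 - a)))"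
  proof -
    have "(\<Sum>k\<le>2 * t. a ^ k) \<le> (\<Sum>k. a ^ k)"
      using a by (intro sum_le_suminf summable_geometric) auto
    also have "\<dots> = 1 / (1 - a)" using a by (intro suminf_geometric) auto
    finally show ?thesis using G r unfolding sum_distrib_left[symmetric] by (intro mult_left_mono) auto
  qed
  finally show ?thesis by (simp add: a_def mult.commute)
qed

theorem concentrated_olives:
  "\<exists>A K :: real. A > 0 \<and> (\<forall>(\<delta> :: real) (t :: nat). \<delta> \<ge> 0 \<longrightarrow> \<delta>\<^sup>2 * real t \<ge> K \<longrightarrow>
    measure_pmf.prob (law t) {x. \<delta> * real t \<le> \<bar>olives x - measure_pmf.expectation (law t) olives\<bar>}
      \<le> exp (- A * \<delta>\<^sup>2 * real t))"
proof -
  obtain A G where A: "0 < A" "1 \<le> G" and tail: "\<And>\<delta> t. 0 \<le> \<delta> \<Longrightarrow> 2 \<le> t \<Longrightarrow>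
      measure_pmf.prob (law t) {x. \<delta> * real t \<le> \<bar>olives x - centre t\<bar>} \<le> G * exp (- A * \<delta>\<^sup>2 * real t)"
    using prob_deviation by blast
  define S where "S = G / (1 - exp (- A))"
  have S: "0 < S" using A by (simp add: S_def)
  \<comment> \<open>For \<open>\<delta> \<le> 1\<close> the three entries give
    \<open>t \<ge> 2\<close>, make the distance from centre to mean at most half the deviation, and
    let half of the exponent \<open>A / 4\<close> absorb \<open>G\<close>.\<close>
  define K where "K = Max {2, (2 * S)\<^sup>2, 8 * ln G / A}"
  have K: "2 \<le> K" "(2 * S)\<^sup>2 \<le> K" "8 * ln G / A \<le> K" by (auto simp: K_def)
  have "measure_pmf.prob (law t) {x. \<delta> * real t \<le> \<bar>olives x - measure_pmf.expectation (law t) olives\<bar>}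
      \<le> exp (- (A / 8) * \<delta>\<^sup>2 * real t)" (is "measure_pmf.prob _ ?D \<le> _")
    if \<delta>: "0 \<le> \<delta>" and dK: "K \<le> \<delta>\<^sup>2 * real t" for \<delta> t
  proof (cases "\<delta> \<le> 1")
    case True
    have "\<delta>\<^sup>2 \<le> 1" using True \<delta> by (simp add: power_le_one)
    then have "\<delta>\<^sup>2 * real t \<le> 1 * real t" by (intro mult_right_mono) auto
    then have t: "2 \<le> t" using dK K by linarith
    have "(2 * S)\<^sup>2 \<le> (\<delta> * sqrt (real t))\<^sup>2" using K dK by (simp add: power_mult_distrib)
    then have "2 * S \<le> \<delta> * sqrt (real t)" by (rule power2_le_imp_le) (use \<delta> in simp)
    then have "2 * S * sqrt (real t) \<le> \<delta> * sqrt (real t) * sqrt (real t)" by (intro mult_right_mono) auto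
    then have half: "S * sqrt (real t) \<le> \<delta> / 2 * real t" by (simp add: mult.assoc)
    have E: "\<bar>measure_pmf.expectation (law t) olives - centre t\<bar> \<le> S * sqrt (real t)"
      unfolding S_def using t A tail by (intro expectation_deviation_le) auto
    have "?D \<subseteq> {x. \<delta> / 2 * real t \<le> \<bar>olives x - centre t\<bar>}"
    proof
      fix x assume "x \<in> ?D"
      then have "\<delta> * real t \<le> \<bar>olives x - measure_pmf.expectation (law t) olives\<bar>" by simp
      then have "\<delta> * real t - S * sqrt (real t) \<le> \<bar>olives x - centre t\<bar>" using E by linarith
      then show "x \<in> {x. \<delta> / 2 * real t \<le> \<bar>olives x - centre t\<bar>}" using half by simp
    qed
    then have "measure_pmf.prob (law t) ?D \<le> measure_pmf.prob (law t) {x. \<delta> / 2 * real t \<le> \<bar>olives x - centre t\<bar>}"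
      by (intro measure_pmf.finite_measure_mono) auto
    also have "\<dots> \<le> G * exp (- A * (\<delta> / 2)\<^sup>2 * real t)" using \<delta> t by (intro tail) auto
    also have "\<dots> = exp (ln G + - A * (\<delta> / 2)\<^sup>2 * real t)" using A by (simp only: exp_add exp_ln)
    also have "\<dots> \<le> exp (- (A / 8) * \<delta>\<^sup>2 * real t)"
    proof -
      have "8 * ln G \<le> A * (\<delta>\<^sup>2 * real t)" using K(3) dK A by (simp add: divide_le_eq mult.commute order_trans)
      then show ?thesis by (simp add: power_divide)
    qed
    finally show ?thesis .
  next
    case False
    \<comment> \<open>For \<open>\<delta> > 1\<close> the event is impossible: olives and mean both
      lie between 0 and \<open>t\<close>, and \<open>t > 0\<close> makes the comparison
      strict.\<close>
    have t: "0 < t" using dK K by (cases t) auto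
    have m: "0 \<le> measure_pmf.expectation (law t) olives" "measure_pmf.expectation (law t) olives \<le> real t"
      using expectation_law_mono[of t "\<lambda>_. 0" olives] expectation_law_mono[of t olives "\<lambda>_. real t"]
      by (simp_all add: olives_nonneg olives_le)
    have "\<bar>olives x - measure_pmf.expectation (law t) olives\<bar> < \<delta> * real t" if "x \<in> set_pmf (law t)" for x
    proof -
      have "\<bar>olives x - measure_pmf.expectation (law t) olives\<bar> \<le> 1 * real t"
        using olives_le[OF that] olives_nonneg[of x] m by linarith
      also have "\<dots> < \<delta> * real t" using False t by (intro mult_strict_right_mono) auto
      finally show ?thesis .
    qed
    then have "measure_pmf.prob (law t) ?D = 0"
      by (subst measure_pmf_zero_iff) (auto simp: not_le disjoint_iff)
    then show ?thesis by simp
  qed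
  then show ?thesis using A by (intro exI[of _ "A / 8"] exI[of _ K]) auto
qed

theorem theorem1:
  shows
    "(\<exists>C c1 c2 :: real. C > 0 \<and> 1 / 342 \<le> c1 \<and> c1 \<le> c2 \<and> c2 \<le> 2 / 3 \<and>
        (\<forall>t :: nat. t \<noteq> 1 \<longrightarrow>
          measure_pmf.prob (game t)
            {h. c1 * real t \<le> olives (h ! t) \<and> olives (h ! t) \<le> c2 * real t}
          \<ge> 1 - exp (- C * real t)))
     \<and>
     (\<exists>A K :: real. A > 0 \<and>
        (\<forall>(\<delta> :: real) (t :: nat). \<delta> \<ge> 0 \<longrightarrow> \<delta>\<^sup>2 * real t \<ge> K \<longrightarrow>
          measure_pmf.prob (game t)
            {h. \<bar>olives (h ! t) - measure_pmf.expectation (game t) (\<lambda>h'. olives (h' ! t))\<bar>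
                  \<ge> \<delta> * real t}
          \<le> exp (- A * \<delta>\<^sup>2 * real t)))
     \<and>
     (\<exists>B :: real. B > 0 \<and>
        ((\<lambda>t :: nat.
            measure_pmf.prob (game t)
              {h. \<forall>s \<le> t. \<forall>i. 1 \<le> i \<and> i < length (h ! s) \<longrightarrow> real (h ! s ! i) \<le> B * ln (real t)})
          \<longlonglongrightarrow> 1))"
proof (intro conjI)
  obtain C where "0 < C" "\<And>t. t \<noteq> 1 \<Longrightarrow> 1 - exp (- C * real t) \<le>
      measure_pmf.prob (law t) {x. 1 / 342 * real t \<le> olives x \<and> olives x \<le> 2 / 3 * real t}"
    using linear_olives by blast
  then have "C > 0 \<and> (1 / 342 :: real) \<le> 1 / 342 \<and> (1 / 342 :: real) \<le> 2 / 3 \<and> (2 / 3 :: real) \<le> 2 / 3 \<and>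
      (\<forall>t :: nat. t \<noteq> 1 \<longrightarrow> measure_pmf.prob (game t)
        {h. 1 / 342 * real t \<le> olives (h ! t) \<and> olives (h ! t) \<le> 2 / 3 * real t} \<ge> 1 - exp (- C * real t))"
    using prob_game_law[OF order_refl, where P = "\<lambda>x. 1 / 342 * real t \<le> olives x \<and> olives x \<le> 2 / 3 * real t" for t]
    by simp
  then show "\<exists>C c1 c2 :: real. C > 0 \<and> 1 / 342 \<le> c1 \<and> c1 \<le> c2 \<and> c2 \<le> 2 / 3 \<and>
        (\<forall>t :: nat. t \<noteq> 1 \<longrightarrow>
          measure_pmf.prob (game t)
            {h. c1 * real t \<le> olives (h ! t) \<and> olives (h ! t) \<le> c2 * real t}
          \<ge> 1 - exp (- C * real t))"
    by blast
  show "\<exists>A K :: real. A > 0 \<and>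
        (\<forall>(\<delta> :: real) (t :: nat). \<delta> \<ge> 0 \<longrightarrow> \<delta>\<^sup>2 * real t \<ge> K \<longrightarrow>
          measure_pmf.prob (game t)
            {h. \<bar>olives (h ! t) - measure_pmf.expectation (game t) (\<lambda>h'. olives (h' ! t))\<bar>
                  \<ge> \<delta> * real t}
          \<le> exp (- A * \<delta>\<^sup>2 * real t))"
    using concentrated_olives
    by (simp only: expectation_game_law[OF order_refl, where f = olives]
        prob_game_law[OF order_refl, where P = "\<lambda>x. \<delta> * real t \<le> \<bar>olives x - E\<bar>" for \<delta> t E])
qed (rule small_plates)

end
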